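(* Let $r\ge 5$ be an integer. Then there is an integer $N=N(r)$ such that, if $n\ge N$ and $D$ is a convex drawing of $K_n$ in the sphere, then there is a subgraph $J$ of $K_n$ isomorphic to $K_r$ such that $D[J]$ is a natural drawing of $K_r$.
   Context: A drawing of a graph in the sphere places vertices at distinct points and represents each edge by a simple arc joining the images of its ends and containing no other vertex image; two arcs meet in finitely many points, arcs of edges sharing an end do not cross, and two edges have at most one point in common. For a subgraph $H$, $D[H]$ is the induced subdrawing. For a 3-cycle $T$, $D[T]$ is a simple closed curve bounding two closed discs (its sides). A side $\Delta$ of $D[T]$ is convex if for any distinct vertices $x,y$ with $D[x],D[y]\in\Delta$, $D[xy]\subseteq\Delta$. $D$ is convex if every 3-cycle has a convex side. A drawing of $K_r$ is natural if some $r$-cycle of $K_r$ is drawn as the boundary of a face of the drawing. *)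

theory Defs
  imports "HOL-Analysis.Analysis"
begin

section \<open>Finite simple graphs\<close>

record 'v ugraph =
  verts :: "'v set"
  edges :: "'v set set"

definition simple_graph :: "'v ugraph \<Rightarrow> bool" where
  "simple_graph G \<longleftrightarrow> finite (verts G) \<and> (\<forall>e\<in>edges G. e \<subseteq> verts G \<and> card e = 2)"

definition subgraph :: "'v ugraph \<Rightarrow> 'v ugraph \<Rightarrow> bool" where
  "subgraph H G \<longleftrightarrow> simple_graph H \<and> verts H \<subseteq> verts G \<and> edges H \<subseteq> edges G"

definition graph_iso :: "'v ugraph \<Rightarrow> 'w ugraph \<Rightarrow> bool" where
  "graph_iso G H \<longleftrightarrow> (\<exists>f. bij_betw f (verts G) (verts H) \<and>
     (\<forall>u\<in>verts G. \<forall>v\<in>verts G. {u, v} \<in> edges G \<longleftrightarrow> {f u, f v} \<in> edges H))"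

definition complete_graph :: "nat \<Rightarrow> nat ugraph" where
  "complete_graph n = \<lparr>verts = {..<n}, edges = {{u, v} |u v. u < n \<and> v < n \<and> u \<noteq> v}\<rparr>"

definition is_cycle :: "nat \<Rightarrow> 'v ugraph \<Rightarrow> bool" where
  "is_cycle k C \<longleftrightarrow> k \<ge> 3 \<and> (\<exists>vs. distinct vs \<and> length vs = k \<and> verts C = set vs \<and>
     edges C = {{vs ! i, vs ! (Suc i mod k)} |i. i < k})"


section \<open>Drawings in the sphere\<close>

abbreviation S2 :: "(real^3) set" where
  "S2 \<equiv> sphere 0 1"

record 'v drawing =
  vpoint :: "'v \<Rightarrow> real^3"
  ecurve :: "'v set \<Rightarrow> (real^3) set"

text \<open>An intersection point of two edges is not required to be transversal.
  Edges with a common end ``do not cross'' in that they meet only at that end.\<close>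

definition is_drawing :: "'v ugraph \<Rightarrow> 'v drawing \<Rightarrow> bool" where
  "is_drawing G D \<longleftrightarrow>
     simple_graph G \<and>
     vpoint D ` verts G \<subseteq> S2 \<and> inj_on (vpoint D) (verts G) \<and>
     (\<forall>u v. {u, v} \<in> edges G \<longrightarrow>
        (\<exists>g. arc g \<and> path_image g = ecurve D {u, v} \<and> path_image g \<subseteq> S2 \<and>
             {pathstart g, pathfinish g} = {vpoint D u, vpoint D v})) \<and>
     (\<forall>e\<in>edges G. \<forall>w\<in>verts G. vpoint D w \<in> ecurve D e \<longrightarrow> w \<in> e) \<and>
     (\<forall>e\<in>edges G. \<forall>f\<in>edges G. e \<noteq> f \<longrightarrow>
        finite (ecurve D e \<inter> ecurve D f) \<and>
        (e \<inter> f \<noteq> {} \<longrightarrow> ecurve D e \<inter> ecurve D f \<subseteq> vpoint D ` (e \<inter> f)) \<and>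
        card (ecurve D e \<inter> ecurve D f) \<le> 1)"

definition induced_drawing :: "'v drawing \<Rightarrow> 'v ugraph \<Rightarrow> 'v drawing" where
  "induced_drawing D H =
     \<lparr>vpoint = restrict (vpoint D) (verts H), ecurve = restrict (ecurve D) (edges H)\<rparr>"

definition drawn :: "'v drawing \<Rightarrow> 'v ugraph \<Rightarrow> (real^3) set" where
  "drawn D H = vpoint D ` verts H \<union> (\<Union>e\<in>edges H. ecurve D e)"

text \<open>Boundaries are taken relative to the sphere: the frontier in the ambient
  space of a subset of the sphere is its whole closure.\<close>

definition is_side :: "'v drawing \<Rightarrow> 'v ugraph \<Rightarrow> (real^3) set \<Rightarrow> bool" where
  "is_side D T \<Delta> \<longleftrightarrow> \<Delta> \<subseteq> S2 \<and> \<Delta> homeomorphic cball (0::real^2) 1 \<and>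
     (top_of_set S2) frontier_of \<Delta> = drawn D T"

definition convex_side :: "'v ugraph \<Rightarrow> 'v drawing \<Rightarrow> 'v ugraph \<Rightarrow> (real^3) set \<Rightarrow> bool" where
  "convex_side G D T \<Delta> \<longleftrightarrow> is_side D T \<Delta> \<and>
     (\<forall>x\<in>verts G. \<forall>y\<in>verts G. x \<noteq> y \<longrightarrow> vpoint D x \<in> \<Delta> \<longrightarrow> vpoint D y \<in> \<Delta> \<longrightarrow>
        ecurve D {x, y} \<subseteq> \<Delta>)"

text \<open>Convexity is meant for drawings of complete graphs, where any two distinct
  vertices \<open>x\<close>, \<open>y\<close> span an edge.\<close>

definition convex_drawing :: "'v ugraph \<Rightarrow> 'v drawing \<Rightarrow> bool" where
  "convex_drawing G D \<longleftrightarrow> is_drawing G D \<and>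
     (\<forall>T. subgraph T G \<and> is_cycle 3 T \<longrightarrow> (\<exists>\<Delta>. convex_side G D T \<Delta>))"

definition is_face :: "'v ugraph \<Rightarrow> 'v drawing \<Rightarrow> (real^3) set \<Rightarrow> bool" where
  "is_face G D F \<longleftrightarrow> F \<in> components (S2 - drawn D G)"

definition natural_drawing :: "'v ugraph \<Rightarrow> 'v drawing \<Rightarrow> bool" where
  "natural_drawing G D \<longleftrightarrow> is_drawing G D \<and>
     (\<exists>C F. subgraph C G \<and> is_cycle (card (verts G)) C \<and> is_face G D F \<and>
        (top_of_set S2) frontier_of F = drawn D C)"

end

(* Fix a convex side for every triangle. If a vertex d lies in the convex side of abc, then the three
   edges from d stay there, and a chord argument shows that the four vertices span a planar drawing.
   As K_5 is not planar, Ramsey's theorem leaves a large set of vertices in which no four span a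
   planar drawing, so that no convex side contains a further vertex. Among four such vertices, exactly
   one of the three pairs of opposite edges crosses properly, and this pair does not depend on the
   triangle used to define "properly"; tangencies of other pairs are still possible. By Ramsey's theorem
   the position of the crossing pair with respect to the order of the vertices may be assumed constant,
   and convexity excludes all patterns except the alternating one, that of points in convex position.
   Taking every other vertex removes the tangencies. The cycle through consecutive vertices is then a
   closed curve met by the remaining edges only at vertices; these cross enough to lie all on the same
   side of it, so the other side is a face. *)

theory Submission
  imports Defs "HOL-Library.Ramsey"
begin

section \<open>Arcs and closed curves\<close>

text \<open>Two edges may touch without crossing, so whether their arcs meet says little, and no
  parity count of crossings is available. The proof therefore asks whether an edge enters the open
  side \<open>cside a b c\<close>. The topology rests mainly on one consequence of the Jordan curve
  theorem: an arc through a side, joining two points of its boundary, cuts the side in two, so a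
  connected set in the closed side that avoids the arc cannot touch the boundary on both sides of
  it. The relation \<open>cross\<close> is not symmetric by definition; its symmetry is derived from
  that fact and from the absence of further vertices in convex sides. Meetings that should not occur
  are excluded by a fifth vertex: if \<open>kl\<close> meets \<open>ij\<close> while
  \<open>ij\<close> crosses \<open>km\<close>, then \<open>kl\<close> has to cross \<open>mi\<close>
  or \<open>mj\<close>. This refutes both bad patterns on five vertices, whence two of the three
  entries 5 in the Ramsey number (the other is the nonplanarity of \<open>K_5\<close>). It is also
  why the alternating set has size \<open>2 * r\<close>: the vertices left out serve as
  \<open>m\<close>.\<close>

text \<open>A drawing gives an edge only as a point set with two ends, so arcs are handled without a
  parametrisation or an orientation.\<close>

definition arc_between :: "'a::topological_space set \<Rightarrow> 'a \<Rightarrow> 'a \<Rightarrow> bool" where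
  "arc_between A x y \<longleftrightarrow> (\<exists>g. arc g \<and> path_image g = A \<and> pathstart g = x \<and> pathfinish g = y)"

lemma arc_between_sym: "arc_between A x y \<Longrightarrow> arc_between A y x"
  unfolding arc_between_def by (metis arc_reversepath path_image_reversepath pathfinish_reversepath pathstart_reversepath)

lemma arc_between_ends: "arc_between A x y \<Longrightarrow> x \<in> A \<and> y \<in> A \<and> x \<noteq> y"
  unfolding arc_between_def by (metis arc_distinct_ends pathfinish_in_path_image pathstart_in_path_image)

lemma arc_between_connected: "arc_between A x y \<Longrightarrow> connected A"
  unfolding arc_between_def using connected_arc_image by blast

lemma arc_between_join:
  assumes "arc_between A x y" "arc_between B y z" "A \<inter> B = {y}"
  shows "arc_between (A \<union> B) x z"
proof -
  from assms obtain g h where g: "arc g" "path_image g = A" "pathstart g = x" "pathfinish g = y"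
    and h: "arc h" "path_image h = B" "pathstart h = y" "pathfinish h = z"
    unfolding arc_between_def by metis
  have "arc (g +++ h)"
    by (rule arc_join) (use g h assms in auto)
  then show ?thesis
    unfolding arc_between_def using g h by (intro exI[of _ "g +++ h"]) (auto simp: path_image_join)
qed

lemma arc_between_split:
  fixes A :: "'a::real_normed_vector set"
  assumes "arc_between A x y" "p \<in> A" "p \<noteq> x" "p \<noteq> y"
  obtains L M where "arc_between L x p" "arc_between M p y" "L \<union> M = A" "L \<inter> M = {p}"
proof -
  obtain g where g: "arc g" "path_image g = A" "pathstart g = x" "pathfinish g = y"
    using assms unfolding arc_between_def by blast
  then obtain t where t: "t \<in> {0..1}" "g t = p" using assms(2) by (auto simp: path_image_def)
  have inj: "inj_on g {0..1}" using g(1) arc_def by blast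
  have t01: "0 < t" "t < 1" using t g assms(3,4)
    by (auto simp: pathstart_def pathfinish_def less_le)
  have a1: "arc (subpath 0 t g)" "arc (subpath t 1 g)"
    using g(1) t01 by (auto intro: arc_subpath_arc)
  have i1: "path_image (subpath 0 t g) = g ` {0..t}" "path_image (subpath t 1 g) = g ` {t..1}"
    using t01 by (auto simp: path_image_subpath)
  have "g ` {0..t} \<union> g ` {t..1} = A"
    using t01 g(2) by (force simp: path_image_def image_Un[symmetric] ivl_disj_un_two_touch)
  moreover have "g ` {0..t} \<inter> g ` {t..1} = g ` ({0..t} \<inter> {t..1})"
    using inj_on_image_Int[OF inj, of "{0..t}" "{t..1}"] t01 by auto
  moreover have "{0..t} \<inter> {t..1} = {t}" using t01 by auto
  ultimately have un: "g ` {0..t} \<union> g ` {t..1} = A" and int: "g ` {0..t} \<inter> g ` {t..1} = {p}"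
    using t(2) by auto
  have "arc_between (g ` {0..t}) x p"
    unfolding arc_between_def using a1(1) i1(1) t(2) g(3)
    by (intro exI[of _ "subpath 0 t g"]) (auto simp: pathstart_def pathfinish_def subpath_def)
  moreover have "arc_between (g ` {t..1}) p y"
    unfolding arc_between_def using a1(2) i1(2) t(2) g(4)
    by (intro exI[of _ "subpath t 1 g"]) (auto simp: pathstart_def pathfinish_def subpath_def)
  ultimately show ?thesis using that un int by blast
qed

lemma arc_between_interior:
  fixes A :: "'a::t2_space set"
  assumes "arc_between A x y"
  shows "connected (A - {x, y})" "A - {x, y} \<noteq> {}" "A \<subseteq> closure (A - {x, y})"
proof -
  obtain g where g: "arc g" "path_image g = A" "pathstart g = x" "pathfinish g = y"
    using assms unfolding arc_between_def by blast
  have inj: "inj_on g {0..1}" and cont: "continuous_on {0..1} g"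
    using g(1) by (auto simp: arc_def path_def)
  have "g ` ({0..1} - {0, 1}) = g ` {0..1} - g ` {0, 1}"
    by (rule inj_on_image_set_diff[OF inj]) auto
  moreover have "{0..1::real} - {0, 1} = {0<..<1}" by auto
  ultimately have eq: "A - {x, y} = g ` {0<..<1}"
    using g by (auto simp: path_image_def pathstart_def pathfinish_def)
  show "connected (A - {x, y})"
    unfolding eq by (rule connected_continuous_image[OF continuous_on_subset[OF cont]]) auto
  show "A - {x, y} \<noteq> {}" unfolding eq by auto
  have "g ` closure {0<..<1} \<subseteq> closure (g ` {0<..<1})"
    by (rule image_closure_subset) (use cont closure_subset[of "g ` {0<..<1}"] in auto)
  then show "A \<subseteq> closure (A - {x, y})"
    unfolding eq using g(2) by (simp add: path_image_def)
qed

text \<open>Serves for edges with one or both ends removed: such a set lies between the open arc,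
  which is connected, and its closure.\<close>

lemma arc_between_connected_sub:
  fixes A :: "'a::t2_space set"
  assumes "arc_between A x y" "A - {x, y} \<subseteq> B" "B \<subseteq> A"
  shows "connected B"
  using connected_intermediate_closure[OF arc_between_interior(1)[OF assms(1)] assms(2)]
    arc_between_interior(3)[OF assms(1)] assms(3) by blast

lemma arc_between_homeomorphism:
  assumes "homeomorphism X Y h k" "arc_between A x y" "A \<subseteq> X"
  shows "arc_between (h ` A) (h x) (h y)"
proof -
  obtain g where g: "arc g" "path_image g = A" "pathstart g = x" "pathfinish g = y"
    using assms unfolding arc_between_def by blast
  have "continuous_on X h" "inj_on h X"
    using assms(1) by (auto simp: homeomorphism_def intro: inj_on_inverseI)
  then have "continuous_on (g ` {0..1}) h" "inj_on h (g ` {0..1})"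
    using g assms(3) by (auto simp: path_image_def elim: continuous_on_subset inj_on_subset)
  then have "arc (h \<circ> g)"
    using g(1) continuous_on_compose[of "{0..1}" g h] comp_inj_on[of g "{0..1}" h]
    unfolding arc_def path_def by blast
  then show ?thesis
    unfolding arc_between_def using g
    by (intro exI[of _ "h \<circ> g"]) (auto simp: path_image_compose pathstart_compose pathfinish_compose)
qed

section \<open>Simple closed curves\<close>

text \<open>Two arcs with common ends, rather than the image of a loop: no base point is singled
  out, and any two of the three arcs of a theta curve qualify at once.\<close>

definition closed_curve :: "'a::topological_space set \<Rightarrow> bool" where
  "closed_curve C \<longleftrightarrow> (\<exists>x y A B. arc_between A x y \<and> arc_between B x y \<and> A \<inter> B = {x, y} \<and> C = A \<union> B)"

lemma closed_curveI:
  "arc_between A x y \<Longrightarrow> arc_between B x y \<Longrightarrow> A \<inter> B = {x, y} \<Longrightarrow> closed_curve (A \<union> B)"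
  unfolding closed_curve_def by blast

lemma closed_curve_simple_path:
  fixes C :: "'a::t2_space set"
  assumes "closed_curve C"
  obtains c where "simple_path c" "pathfinish c = pathstart c" "path_image c = C"
proof -
  obtain x y A B where "arc_between A x y" "arc_between B x y" and AB: "A \<inter> B = {x, y}" and C: "C = A \<union> B"
    using assms unfolding closed_curve_def by blast
  then obtain g h where g: "arc g" "path_image g = A" "pathstart g = x" "pathfinish g = y"
    and h: "arc h" "path_image h = B" "pathstart h = y" "pathfinish h = x"
    unfolding arc_between_def
    by (metis arc_reversepath path_image_reversepath pathfinish_reversepath pathstart_reversepath)
  have "simple_path (g +++ h)"
    by (rule simple_path_join_loop) (use g h AB in auto)
  then show ?thesis using that[of "g +++ h"] g h C by (auto simp: path_image_join)
qed

lemma closed_curve_homeomorphism: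
  assumes "homeomorphism X Y h k" "closed_curve C" "C \<subseteq> X"
  shows "closed_curve (h ` C)"
proof -
  obtain x y A B where ab: "arc_between A x y" "arc_between B x y" and AB: "A \<inter> B = {x, y}" and C: "C = A \<union> B"
    using assms unfolding closed_curve_def by blast
  have inj: "inj_on h X"
    using assms(1) by (auto simp: homeomorphism_def intro: inj_on_inverseI)
  have sub: "A \<subseteq> X" "B \<subseteq> X" using C assms(3) by auto
  have "h ` A \<inter> h ` B = h ` (A \<inter> B)"
    using inj_on_image_Int[OF inj sub] by simp
  then have "h ` A \<inter> h ` B = {h x, h y}" using AB by auto
  then show ?thesis
    unfolding C image_Un using arc_between_homeomorphism[OF assms(1)] ab sub by (intro closed_curveI) auto
qed

lemma closed_curve_homeomorphic_circle:
  fixes C :: "'a::t2_space set"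
  assumes "closed_curve C"
  shows "C homeomorphic sphere (0::complex) 1"
  using closed_curve_simple_path[OF assms] homeomorphic_simple_path_image_circle
  by (metis zero_less_one)

lemma closed_curve_nonempty: "closed_curve C \<Longrightarrow> C \<noteq> {}"
  unfolding closed_curve_def using arc_between_ends by blast

text \<open>The sphere is simply connected and a circle is not. A point off the curve is needed as a
  centre of projection to the plane.\<close>

lemma closed_curve_subset_S2_proper:
  assumes "closed_curve C" "C \<subseteq> S2"
  obtains p where "p \<in> S2" "p \<notin> C"
proof -
  have "C \<noteq> S2"
  proof
    assume "C = S2"
    then have "S2 homeomorphic sphere (0::complex) 1"
      using closed_curve_homeomorphic_circle[OF assms(1)] by simp
    then have "simply_connected S2 \<longleftrightarrow> simply_connected (sphere (0::complex) 1)"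
      by (rule homeomorphic_simply_connected_eq)
    then show False by (simp add: simply_connected_sphere_eq)
  qed
  then show ?thesis using that assms(2) by blast
qed

lemma punctured_S2_homeomorphism:
  assumes "p \<in> S2"
  obtains h k where "homeomorphism (S2 - {p}) (UNIV::complex set) h k"
proof -
  have "(S2 - {p}) homeomorphic (UNIV::complex set)"
    using homeomorphic_punctured_affine_sphere_affine[of 1 p 0 UNIV "UNIV :: complex set"] assms
    by (simp add: aff_dim_UNIV)
  then show ?thesis using that homeomorphic_def by blast
qed

section \<open>The Jordan curve theorem and theta curves in the sphere\<close>

definition jordan_sides :: "(real^3) set \<Rightarrow> (real^3) set \<Rightarrow> (real^3) set \<Rightarrow> bool" where
  "jordan_sides C U V \<longleftrightarrow> connected U \<and> connected V \<and> U \<noteq> {} \<and> V \<noteq> {} \<and> U \<inter> V = {} \<and> U \<union> V = S2 - C \<and>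
     openin (top_of_set S2) U \<and> openin (top_of_set S2) V \<and> closure U = U \<union> C \<and> closure V = V \<union> C"

lemma jordan_sides_sym: "jordan_sides C U V \<Longrightarrow> jordan_sides C V U"
  unfolding jordan_sides_def by (auto simp: Un_commute Int_commute)

text \<open>The planar Jordan curve theorem is pulled back along the projection from
  \<open>p\<close>, and \<open>p\<close> itself joins the image of the unbounded component. Both
  sides are named explicitly because \<open>theta_S2\<close> has to know which one is the
  inside.\<close>

lemma jordan_sides_projection:
  fixes h :: "real^3 \<Rightarrow> complex"
  assumes hom: "homeomorphism (S2 - {p}) UNIV h k" and p: "p \<in> S2"
    and C: "closed_curve C" "C \<subseteq> S2" "p \<notin> C"
  shows "jordan_sides C (k ` inside (h ` C)) (insert p (k ` outside (h ` C)))"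
proof -
  let ?C = "h ` C" and ?I = "inside (h ` C)" and ?O = "outside (h ` C)"
  have "C \<subseteq> S2 - {p}" using C by auto
  then have "closed_curve ?C" using closed_curve_homeomorphism[OF hom C(1)] by simp
  then obtain c where "simple_path c" "pathfinish c = pathstart c" "path_image c = ?C"
    using closed_curve_simple_path by metis
  then have J: "?I \<noteq> {}" "open ?I" "connected ?I" "?O \<noteq> {}" "open ?O" "connected ?O" "bounded ?I"
    "\<not> bounded ?O" "?I \<inter> ?O = {}" "?I \<union> ?O = - ?C" "frontier ?I = ?C" "frontier ?O = ?C"
    using Jordan_inside_outside[of c] by auto
  have hom': "homeomorphism UNIV (S2 - {p}) k h" using hom homeomorphism_sym by blast
  have kh: "\<And>x. x \<in> S2 - {p} \<Longrightarrow> k (h x) = x" and hk: "\<And>z. h (k z) = z"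
    and kU: "k ` UNIV = S2 - {p}" and ck: "continuous_on UNIV k" and ch: "continuous_on (S2 - {p}) h"
    using hom by (auto simp: homeomorphism_def)
  have injk: "inj k" using hk by (metis injI)
  have kC: "k ` ?C = C"
    using kh C by (force simp: image_image)
  have clI: "closure ?I = ?I \<union> ?C" and clO: "closure ?O = ?O \<union> ?C"
    using J(11,12) by (metis closure_Un_frontier)+
  have img: "k ` X \<inter> k ` Y = k ` (X \<inter> Y)" for X Y
    using injk by (simp add: image_Int)
  have cov: "k ` ?I \<union> insert p (k ` ?O) = S2 - C"
  proof -
    have "k ` ?I \<union> k ` ?O = k ` (UNIV - ?C)" using J(10) by (metis Compl_eq_Diff_UNIV image_Un)
    also have "\<dots> = S2 - {p} - C"
      using image_set_diff[OF injk, of UNIV ?C] kU kC by simp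
    finally show ?thesis using C p by auto
  qed
  have pk: "p \<notin> k ` X" for X using kU by auto
  have disj: "k ` ?I \<inter> insert p (k ` ?O) = {}"
    using img[of ?I ?O] J(9) pk by auto
  have opU: "openin (top_of_set S2) (k ` ?I)"
  proof -
    have "openin (top_of_set (S2 - {p})) (k ` ?I)"
      using homeomorphism_imp_open_map[OF hom', of ?I] J(2) by simp
    moreover have "openin (top_of_set S2) (S2 - {p})"
      by (simp add: openin_delete)
    ultimately show ?thesis using openin_trans by blast
  qed
  have "compact (?I \<union> ?C)" using J(7) clI by (metis compact_closure)
  then have cmpI: "compact (k ` (?I \<union> ?C))"
    using compact_continuous_image continuous_on_subset[OF ck] by blast
  have opV: "openin (top_of_set S2) (insert p (k ` ?O))"
  proof -
    have "insert p (k ` ?O) = S2 - k ` (?I \<union> ?C)"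
      using cov disj kC C by (auto simp: image_Un)
    then show ?thesis using compact_imp_closed[OF cmpI]
      by (simp add: Diff_eq open_Compl openin_open_Int)
  qed
  have clos: "C \<subseteq> closure (k ` X)" if "frontier X = ?C" for X
  proof -
    have "k ` closure X \<subseteq> closure (k ` X)"
      by (rule image_closure_subset) (use continuous_on_subset[OF ck] closure_subset[of "k ` X"] in auto)
    moreover have "?C \<subseteq> closure X" using that unfolding frontier_def by (metis Diff_subset)
    ultimately show ?thesis using kC by blast
  qed
  have clU: "closure (k ` ?I) = k ` ?I \<union> C"
  proof
    show "closure (k ` ?I) \<subseteq> k ` ?I \<union> C"
      using closure_minimal[of "k ` ?I" "k ` (?I \<union> ?C)"] compact_imp_closed[OF cmpI] kC
      by (auto simp: image_Un)
    show "k ` ?I \<union> C \<subseteq> closure (k ` ?I)"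
      using clos[OF J(11)] closure_subset by blast
  qed
  have clV: "closure (insert p (k ` ?O)) = insert p (k ` ?O) \<union> C"
  proof
    have "closed (S2 - k ` ?I)"
      using closedin_diff[OF closedin_topspace opU] closedin_closed_trans[OF _ closed_sphere] by simp
    moreover have "S2 - k ` ?I = insert p (k ` ?O) \<union> C"
      using cov disj C by blast
    ultimately show "closure (insert p (k ` ?O)) \<subseteq> insert p (k ` ?O) \<union> C"
      by (metis closure_minimal Un_upper1)
    show "insert p (k ` ?O) \<union> C \<subseteq> closure (insert p (k ` ?O))"
      using clos[OF J(12)] closure_subset closure_mono[of "k ` ?O" "insert p (k ` ?O)"] by blast
  qed
  \<comment> \<open>If a ball around \<open>p\<close> missed the image of the outside, the outside
    would lie in the image under \<open>h\<close> of a compact set and be bounded.\<close>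
  have "p \<in> closure (k ` ?O)"
  proof (rule ccontr)
    assume "p \<notin> closure (k ` ?O)"
    then obtain e where e: "e > 0" "\<forall>y\<in>k ` ?O. \<not> dist y p < e"
      unfolding closure_approachable by blast
    have "compact (S2 - ball p e)" by (simp add: compact_diff)
    moreover have "continuous_on (S2 - ball p e) h"
      by (rule continuous_on_subset[OF ch]) (use e in auto)
    ultimately have "bounded (h ` (S2 - ball p e))"
      using compact_continuous_image compact_imp_bounded by blast
    moreover have "?O \<subseteq> h ` (S2 - ball p e)"
    proof
      fix z assume z: "z \<in> ?O"
      have "k z \<in> S2" using kU by blast
      moreover have "k z \<notin> ball p e" using e(2) z by (auto simp: dist_commute)
      ultimately show "z \<in> h ` (S2 - ball p e)" using hk[of z] by (metis DiffI image_eqI)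
    qed
    ultimately show False using J(8) bounded_subset by blast
  qed
  moreover have "connected (k ` ?I)" and cO: "connected (k ` ?O)"
    using connected_continuous_image[OF continuous_on_subset[OF ck subset_UNIV]] J(3,6) by blast+
  ultimately have "connected (insert p (k ` ?O))"
    using connected_intermediate_closure[OF cO, of "insert p (k ` ?O)"] closure_subset[of "k ` ?O"]
    by (metis insert_subset subset_insertI)
  then show ?thesis
    unfolding jordan_sides_def using \<open>connected (k ` ?I)\<close> J(1) cov disj opU opV clU clV by simp
qed

lemma jordan_sides_components:
  assumes "jordan_sides C U V" shows "components (S2 - C) = {U, V}"
proof -
  have comp: "U \<in> components (S2 - C)" if "jordan_sides C U V" for U V
  proof -
    note J = that[unfolded jordan_sides_def]
    have UV: "U \<inter> V = {}" "U \<union> V = S2 - C" "U \<noteq> {}" "connected U" using J by auto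
    obtain A B where AB: "open A" "open B" "U = S2 \<inter> A" "V = S2 \<inter> B"
      using J by (metis openin_open)
    have max: "U' = U" if U': "U \<subseteq> U'" "U' \<subseteq> S2 - C" "connected U'" for U'
    proof -
      have "U' \<subseteq> S2" "U' \<subseteq> U \<union> V" using U'(2) UV(2) by auto
      then have "A \<inter> B \<inter> U' = {}" "U' \<subseteq> A \<union> B" using AB UV(1) by auto
      then have "A \<inter> U' = {} \<or> B \<inter> U' = {}" using connectedD[OF U'(3) AB(1,2)] by blast
      moreover have "A \<inter> U' \<noteq> {}" using U'(1) UV(3) AB(3) by blast
      ultimately have "V \<inter> U' = {}" using AB(4) by blast
      then show ?thesis using U'(1) \<open>U' \<subseteq> U \<union> V\<close> by blast
    qed
    have "U \<subseteq> S2 - C" using UV(2) by blast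
    then show ?thesis unfolding in_components_maximal using UV(3,4) max by blast
  qed
  have "U \<in> components (S2 - C)" "V \<in> components (S2 - C)"
    using comp assms jordan_sides_sym by blast+
  moreover have "W = U \<or> W = V" if W: "W \<in> components (S2 - C)" for W
  proof -
    obtain x where x: "x \<in> W" using in_components_nonempty[OF W] by blast
    have "x \<in> U \<union> V" using assms x in_components_subset[OF W] unfolding jordan_sides_def by blast
    then show ?thesis
      using components_eq[OF W \<open>U \<in> _\<close>] components_eq[OF W \<open>V \<in> _\<close>] x by blast
  qed
  ultimately show ?thesis by blast
qed

lemma jordan_sides_exist:
  assumes "closed_curve C" "C \<subseteq> S2"
  obtains U V where "jordan_sides C U V" "components (S2 - C) = {U, V}"
proof -
  obtain p where p: "p \<in> S2" "p \<notin> C" using closed_curve_subset_S2_proper assms by metis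
  obtain h :: "real^3 \<Rightarrow> complex" and k where "homeomorphism (S2 - {p}) UNIV h k"
    using punctured_S2_homeomorphism[OF p(1)] by metis
  then show ?thesis using that jordan_sides_projection p assms jordan_sides_components by metis
qed

lemma component_other_side:
  assumes "closed_curve C" "C \<subseteq> S2" "U \<in> components (S2 - C)"
  obtains V where "jordan_sides C U V" "V \<in> components (S2 - C)"
proof -
  obtain U' V' where "jordan_sides C U' V'" "components (S2 - C) = {U', V'}"
    using jordan_sides_exist assms by metis
  then show ?thesis using that jordan_sides_sym assms by (metis insert_iff empty_iff)
qed

lemma component_closure:
  assumes "closed_curve C" "C \<subseteq> S2" "U \<in> components (S2 - C)"
  shows "closure U = U \<union> C"
  using component_other_side[OF assms] unfolding jordan_sides_def by metis

lemma component_openin: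
  assumes "closed_curve C" "C \<subseteq> S2" "U \<in> components (S2 - C)"
  shows "openin (top_of_set S2) U"
  using component_other_side[OF assms] unfolding jordan_sides_def by metis

section \<open>Theta curves\<close>

lemma inside_arcs_split:
  fixes A B C :: "complex set"
  assumes "arc_between A x y" "arc_between B x y" "arc_between C x y"
    and "A \<inter> B = {x, y}" "A \<inter> C = {x, y}" "B \<inter> C = {x, y}" "C \<inter> inside (A \<union> B) \<noteq> {}"
  shows "inside (A \<union> C) \<inter> inside (B \<union> C) = {}"
    "inside (A \<union> C) \<union> inside (B \<union> C) \<union> (C - {x, y}) = inside (A \<union> B)"
proof -
  obtain a b c where
    "arc a" "path_image a = A" "pathstart a = x" "pathfinish a = y"
    "arc b" "path_image b = B" "pathstart b = x" "pathfinish b = y"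
    "arc c" "path_image c = C" "pathstart c = x" "pathfinish c = y"
    using assms(1-3) unfolding arc_between_def by metis
  moreover have "x \<noteq> y" using assms(1) arc_between_ends by blast
  ultimately have "inside (A \<union> C) \<inter> inside (B \<union> C) = {} \<and>
    inside (A \<union> C) \<union> inside (B \<union> C) \<union> (C - {x, y}) = inside (A \<union> B)"
    using split_inside_simple_closed_curve[of a x y b c] assms(4-7) by (metis arc_imp_simple_path)
  then show "inside (A \<union> C) \<inter> inside (B \<union> C) = {}"
    "inside (A \<union> C) \<union> inside (B \<union> C) \<union> (C - {x, y}) = inside (A \<union> B)" by auto
qed

text \<open>Projecting from a point of the other side turns \<open>U\<close> into the inside of a
  plane curve, where \<open>inside_arcs_split\<close> applies.\<close>

lemma theta_S2:
  assumes "arc_between A x y" "arc_between B x y" "arc_between C x y"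
    and sub: "A \<subseteq> S2" "B \<subseteq> S2" "C \<subseteq> S2"
    and AB: "A \<inter> B = {x, y}" and AC: "A \<inter> C = {x, y}" and BC: "B \<inter> C = {x, y}"
    and U: "U \<in> components (S2 - (A \<union> B))" and CU: "C \<inter> U \<noteq> {}"
  obtains R1 R2 where "R1 \<in> components (S2 - (A \<union> C))" "R2 \<in> components (S2 - (B \<union> C))"
    "R1 \<inter> R2 = {}" "U = R1 \<union> R2 \<union> (C - {x, y})"
proof -
  have cc: "closed_curve (A \<union> B)" "closed_curve (A \<union> C)" "closed_curve (B \<union> C)"
    using closed_curveI[OF assms(1,2) AB] closed_curveI[OF assms(1,3) AC] closed_curveI[OF assms(2,3) BC] .
  obtain V where V: "jordan_sides (A \<union> B) U V" "V \<in> components (S2 - (A \<union> B))"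
    using component_other_side[OF cc(1) _ U] sub by blast
  then obtain p where pV: "p \<in> V" unfolding jordan_sides_def by blast
  have UV: "U \<inter> V = {}" "U \<union> V = S2 - (A \<union> B)" using V(1) unfolding jordan_sides_def by auto
  have pAB: "p \<in> S2" "p \<notin> A \<union> B" using pV UV by auto
  \<comment> \<open>The open arc is connected and misses \<open>A\<close> and \<open>B\<close>, so
    all of it lies in \<open>U\<close>; hence the centre \<open>p\<close> is not on
    \<open>C\<close>.\<close>
  have "C - {x, y} \<subseteq> U"
  proof (rule components_maximal[OF U arc_between_interior(1)[OF assms(3)]])
    show "C - {x, y} \<subseteq> S2 - (A \<union> B)" using sub(3) AC BC by blast
    show "U \<inter> (C - {x, y}) \<noteq> {}" using CU in_components_subset[OF U] AB by blast
  qed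
  then have pC: "p \<notin> C"
    using pAB(2) pV UV(1) AB by auto
  obtain h :: "real^3 \<Rightarrow> complex" and k where hk: "homeomorphism (S2 - {p}) UNIV h k"
    using punctured_S2_homeomorphism[OF pAB(1)] by metis
  note proj = jordan_sides_projection[OF hk pAB(1)]
  have subp: "A \<subseteq> S2 - {p}" "B \<subseteq> S2 - {p}" "C \<subseteq> S2 - {p}" using sub pAB pC by auto
  have injh: "inj_on h (S2 - {p})" using hk by (auto simp: homeomorphism_def intro: inj_on_inverseI)
  have kh: "\<And>x. x \<in> S2 - {p} \<Longrightarrow> k (h x) = x" and hk': "\<And>z. h (k z) = z" using hk by (auto simp: homeomorphism_def)
  have injk: "inj k" using hk' by (metis injI)
  have khC: "k ` h ` X = X" if "X \<subseteq> S2 - {p}" for X using that kh by (force simp: image_image)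
  have sides: "jordan_sides (A \<union> B) (k ` inside (h ` A \<union> h ` B)) (insert p (k ` outside (h ` A \<union> h ` B)))"
    "jordan_sides (A \<union> C) (k ` inside (h ` A \<union> h ` C)) (insert p (k ` outside (h ` A \<union> h ` C)))"
    "jordan_sides (B \<union> C) (k ` inside (h ` B \<union> h ` C)) (insert p (k ` outside (h ` B \<union> h ` C)))"
    using proj cc sub pAB pC by (auto simp: image_Un[symmetric])
  note comps = sides[THEN jordan_sides_components]
  have VV: "V = insert p (k ` outside (h ` A \<union> h ` B))"
    using components_eq[OF V(2)] comps(1) pV by blast
  have UU: "U = k ` inside (h ` A \<union> h ` B)"
  proof -
    have "k ` inside (h ` A \<union> h ` B) \<inter> V = {}" "k ` inside (h ` A \<union> h ` B) \<union> V = S2 - (A \<union> B)"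
      using sides(1) unfolding VV jordan_sides_def by simp_all
    then show ?thesis using UV by blast
  qed
  have meets: "h ` A \<inter> h ` B = {h x, h y}" "h ` A \<inter> h ` C = {h x, h y}" "h ` B \<inter> h ` C = {h x, h y}"
    using inj_on_image_Int[OF injh subp(1,2)] inj_on_image_Int[OF injh subp(1,3)]
      inj_on_image_Int[OF injh subp(2,3)] AB AC BC by auto
  have hCin: "h ` C \<inter> inside (h ` A \<union> h ` B) \<noteq> {}"
  proof -
    obtain w where w: "w \<in> C" "w \<in> U" using CU by blast
    then obtain z where z: "z \<in> inside (h ` A \<union> h ` B)" "w = k z" unfolding UU by (rule_tac imageE)
    then have "z = h w" using hk' by simp
    then show ?thesis using w(1) z(1) by blast
  qed
  have arcs: "arc_between (h ` A) (h x) (h y)" "arc_between (h ` B) (h x) (h y)" "arc_between (h ` C) (h x) (h y)"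
    using arc_between_homeomorphism[OF hk] assms(1-3) subp by blast+
  note ins = inside_arcs_split[OF arcs meets hCin]
  let ?R1 = "k ` inside (h ` A \<union> h ` C)" and ?R2 = "k ` inside (h ` B \<union> h ` C)"
  have xy: "x \<in> S2 - {p}" "y \<in> S2 - {p}" using subp(3) BC by auto
  have "k ` (h ` C - {h x, h y}) = k ` h ` C - k ` {h x, h y}"
    by (rule image_set_diff[OF injk])
  also have "\<dots> = C - {x, y}" using khC[OF subp(3)] kh[OF xy(1)] kh[OF xy(2)] by simp
  finally have "U = ?R1 \<union> ?R2 \<union> (C - {x, y})"
    unfolding UU ins(2)[symmetric] by (simp only: image_Un)
  moreover have "?R1 \<inter> ?R2 = {}"
    using ins(1) image_Int[OF injk] by (metis image_empty)
  moreover have "?R1 \<in> components (S2 - (A \<union> C))" "?R2 \<in> components (S2 - (B \<union> C))"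
    unfolding comps by simp_all
  ultimately show ?thesis using that by metis
qed

section \<open>Triangles in convex drawings\<close>

text \<open>Retains what the combinatorial part uses of a drawing. The sides of a triangle are
  closures of components of its complement here; \<open>side_closure_component\<close> connects them
  with the discs of the definition.\<close>

locale convex_complete_drawing =
  fixes V :: "'v set" and P :: "'v \<Rightarrow> real^3" and E :: "'v \<Rightarrow> 'v \<Rightarrow> (real^3) set"
  assumes inj_P: "inj_on P V"
    and E_commute: "E u v = E v u"
    and E_arc: "\<lbrakk>u \<in> V; v \<in> V; u \<noteq> v\<rbrakk> \<Longrightarrow> arc_between (E u v) (P u) (P v)"
    and E_S2: "\<lbrakk>u \<in> V; v \<in> V; u \<noteq> v\<rbrakk> \<Longrightarrow> E u v \<subseteq> S2"
    and E_vertex: "\<lbrakk>u \<in> V; v \<in> V; w \<in> V; u \<noteq> v; P w \<in> E u v\<rbrakk> \<Longrightarrow> w = u \<or> w = v"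
    and E_adjacent: "\<lbrakk>u \<in> V; v \<in> V; w \<in> V; distinct [u, v, w]\<rbrakk> \<Longrightarrow> E u v \<inter> E u w \<subseteq> {P u}"
    and E_meet_once: "\<lbrakk>u \<in> V; v \<in> V; x \<in> V; y \<in> V; distinct [u, v, x, y];
      p \<in> E u v \<inter> E x y; q \<in> E u v \<inter> E x y\<rbrakk> \<Longrightarrow> p = q"
    and convexity: "\<lbrakk>a \<in> V; b \<in> V; c \<in> V; distinct [a, b, c]\<rbrakk> \<Longrightarrow>
      \<exists>U \<in> components (S2 - (E a b \<union> E b c \<union> E a c)). \<forall>x\<in>V. \<forall>y\<in>V. x \<noteq> y \<longrightarrow>
        P x \<in> closure U \<longrightarrow> P y \<in> closure U \<longrightarrow> E x y \<subseteq> closure U"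
begin

definition tri :: "'v \<Rightarrow> 'v \<Rightarrow> 'v \<Rightarrow> (real^3) set" where
  "tri a b c = E a b \<union> E b c \<union> E a c"

text \<open>The choice depends only on the point set \<open>tri a b c\<close>, so it does not change
  when the vertices are permuted.\<close>

definition cside :: "'v \<Rightarrow> 'v \<Rightarrow> 'v \<Rightarrow> (real^3) set" where
  "cside a b c = (SOME U. U \<in> components (S2 - tri a b c) \<and> (\<forall>x\<in>V. \<forall>y\<in>V. x \<noteq> y \<longrightarrow>
        P x \<in> closure U \<longrightarrow> P y \<in> closure U \<longrightarrow> E x y \<subseteq> closure U))"

text \<open>A tangency of opposite edges already makes this false, so its negation does not at once
  yield a crossing; \<open>cross_exists\<close> provides one.\<close>

definition planar4 :: "'v \<Rightarrow> 'v \<Rightarrow> 'v \<Rightarrow> 'v \<Rightarrow> bool" where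
  "planar4 a b c d \<longleftrightarrow> E a b \<inter> E c d = {} \<and> E a c \<inter> E b d = {} \<and> E a d \<inter> E b c = {}"

abbreviation vs :: "'v list \<Rightarrow> bool" where
  "vs xs \<equiv> distinct xs \<and> set xs \<subseteq> V"

lemma tri_perm: "tri a b c = tri b a c" "tri a b c = tri a c b"
  unfolding tri_def using E_commute by blast+

lemma cside_perm: "cside a b c = cside b a c" "cside a b c = cside a c b"
  unfolding cside_def using tri_perm by metis+

lemma planar4_perm: "planar4 a b c d = planar4 b a c d" "planar4 a b c d = planar4 a c b d"
  "planar4 a b c d = planar4 a b d c"
  unfolding planar4_def using E_commute by blast+

lemma cside:
  assumes "vs [a, b, c]"
  shows "cside a b c \<in> components (S2 - tri a b c)"
    and "\<lbrakk>x \<in> V; y \<in> V; x \<noteq> y; P x \<in> closure (cside a b c); P y \<in> closure (cside a b c)\<rbrakk> \<Longrightarrow>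
      E x y \<subseteq> closure (cside a b c)"
proof -
  have "\<exists>U. U \<in> components (S2 - tri a b c) \<and> (\<forall>x\<in>V. \<forall>y\<in>V. x \<noteq> y \<longrightarrow>
        P x \<in> closure U \<longrightarrow> P y \<in> closure U \<longrightarrow> E x y \<subseteq> closure U)"
    using convexity[of a b c] assms unfolding tri_def by auto
  from someI_ex[OF this]
  show "cside a b c \<in> components (S2 - tri a b c)"
    and "\<lbrakk>x \<in> V; y \<in> V; x \<noteq> y; P x \<in> closure (cside a b c); P y \<in> closure (cside a b c)\<rbrakk> \<Longrightarrow>
      E x y \<subseteq> closure (cside a b c)"
    unfolding cside_def by blast+
qed

lemma E_ends: "vs [u, v] \<Longrightarrow> P u \<in> E u v" "vs [u, v] \<Longrightarrow> P v \<in> E u v"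
  using arc_between_ends[OF E_arc[of u v]] by auto

lemma P_S2: "vs [u, v] \<Longrightarrow> P u \<in> S2"
  using E_S2[of u v] E_ends(1)[of u v] by auto

lemma P_eq: "vs [u, v] \<Longrightarrow> P u \<noteq> P v"
  using inj_P by (auto simp: inj_on_def)

lemma E_inter: assumes "vs [u, v, w]" shows "E u v \<inter> E u w = {P u}"
  using E_adjacent[of u v w] E_ends(1)[of u v] E_ends(1)[of u w] assms by auto

lemma E_inter': assumes "vs [u, v, w]" shows "E v u \<inter> E w u = {P u}" "E u v \<inter> E w u = {P u}" "E v u \<inter> E u w = {P u}"
  using E_inter[OF assms] E_commute by metis+

lemma P_notin_E: "vs [u, v, w] \<Longrightarrow> P w \<notin> E u v"
  using E_vertex[of u v w] by auto

lemma P_notin_tri: "vs [a, b, c, d] \<Longrightarrow> P d \<notin> tri a b c"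
  unfolding tri_def using P_notin_E[of a b d] P_notin_E[of b c d] P_notin_E[of a c d] by auto

lemma tri_vertices: assumes "vs [a, b, c]" shows "P a \<in> tri a b c" "P b \<in> tri a b c" "P c \<in> tri a b c"
  unfolding tri_def using E_ends[of a b] E_ends[of b c] assms by auto

lemma tri_S2: "vs [a, b, c] \<Longrightarrow> tri a b c \<subseteq> S2"
  unfolding tri_def using E_S2 by auto

lemma two_arc: assumes "vs [a, b, c]" shows "arc_between (E a b \<union> E b c) (P a) (P c)"
  using arc_between_join[OF E_arc[of a b] E_arc[of b c]] E_inter'(3)[of b a c] assms by auto

lemma closed_curve_tri: assumes "vs [a, b, c]" shows "closed_curve (tri a b c)"
proof -
  have "(E a b \<union> E b c) \<inter> E a c = {P a, P c}"
    using E_inter[of a b c] E_inter'(1)[of c b a] assms by auto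
  then show ?thesis
    unfolding tri_def using closed_curveI[OF two_arc[OF assms] E_arc[of a c]] assms by auto
qed

lemma E_meet_subset: "\<lbrakk>vs [a, b, c, d]; p \<in> E a b; p \<in> E c d\<rbrakk> \<Longrightarrow> E c d \<inter> E a b \<subseteq> {p}"
  using E_meet_once[of a b c d] by auto

lemma triangle_component:
  assumes "vs [a, b, c]" "U \<in> components (S2 - tri a b c)"
  shows "closure U = U \<union> tri a b c" "openin (top_of_set S2) U" "U \<subseteq> S2" "U \<inter> tri a b c = {}" "connected U"
proof -
  show "closure U = U \<union> tri a b c" "openin (top_of_set S2) U"
    using component_closure component_openin closed_curve_tri[OF assms(1)] tri_S2[OF assms(1)] assms(2) by blast+
  show "U \<subseteq> S2" "U \<inter> tri a b c = {}" "connected U"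
    using in_components_subset[OF assms(2)] in_components_connected[OF assms(2)] by blast+
qed

section \<open>Chords across a side of a triangle\<close>

text \<open>With the two paths from \<open>c\<close> to \<open>p\<close> along the triangle, through
  \<open>a\<close> and through \<open>b\<close>, the chord \<open>C\<close> forms a theta curve. The
  closures of the two halves of \<open>U\<close> share only points of \<open>C\<close>, so the
  connected set \<open>X\<close>, which meets \<open>ac\<close>, misses the closed half that
  contains \<open>bc\<close>.\<close>

lemma chord_separates:
  assumes v: "vs [a, b, c]" and U: "U \<in> components (S2 - tri a b c)"
    and C: "arc_between C (P c) p" "C \<subseteq> S2" "C \<inter> tri a b c = {P c, p}" "C \<inter> U \<noteq> {}"
    and p: "p \<in> E a b" "p \<noteq> P a" "p \<noteq> P b"
    and X: "connected X" "X \<subseteq> closure U" "X \<inter> C = {}" "X \<inter> E a c \<noteq> {}"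
  shows "X \<inter> E b c = {}"
proof
  obtain La Lb where L: "arc_between La (P a) p" "arc_between Lb p (P b)" "La \<union> Lb = E a b" "La \<inter> Lb = {p}"
    using arc_between_split[OF E_arc[of a b] p] v by auto
  have ic: "E a b \<inter> E a c = {P a}" "E a b \<inter> E b c = {P b}" "E a c \<inter> E b c = {P c}"
    using E_inter[of a b c] E_inter'(3)[of b a c] E_inter'(1)[of c a b] v by auto
  have PL: "P a \<in> La" "P b \<in> Lb" "P a \<notin> Lb" "P b \<notin> La" "p \<in> La" "p \<in> Lb"
    using L(4) p(2,3) arc_between_ends[OF L(1)] arc_between_ends[OF L(2)] by (metis IntI singletonD)+
  have A: "arc_between (E a c \<union> La) (P c) p"
    using arc_between_join[OF arc_between_sym[OF E_arc[of a c]] L(1)] ic(1) L(3) PL v by auto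
  have B: "arc_between (E b c \<union> Lb) (P c) p"
    using arc_between_join[OF arc_between_sym[OF E_arc[of b c]] arc_between_sym[OF L(2)]] ic(2) L(3) PL v by auto
  have ends: "P c \<in> E a c" "P c \<in> E b c" using E_ends(2)[of a c] E_ends(2)[of b c] v by auto
  have T: "tri a b c = (E a c \<union> La) \<union> (E b c \<union> Lb)" unfolding tri_def using L(3) by blast
  have AB0: "(E a c \<union> La) \<inter> (E b c \<union> Lb) = {P c, p}"
  proof -
    have "E a c \<inter> Lb \<subseteq> E a b \<inter> E a c" "La \<inter> E b c \<subseteq> E a b \<inter> E b c" using L(3) by auto
    then have "E a c \<inter> Lb = {}" "La \<inter> E b c = {}" using ic PL by auto
    then show ?thesis using ic(3) L(4) by auto
  qed
  have AC0: "(E a c \<union> La) \<inter> C = {P c, p}" "(E b c \<union> Lb) \<inter> C = {P c, p}"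
    using C(3) ends PL unfolding T by blast+
  have S2s: "E a c \<union> La \<subseteq> S2" "E b c \<union> Lb \<subseteq> S2" using tri_S2[OF v] T by auto
  obtain R1 R2 where R: "R1 \<in> components (S2 - ((E a c \<union> La) \<union> C))" "R2 \<in> components (S2 - ((E b c \<union> Lb) \<union> C))"
    "R1 \<inter> R2 = {}" "U = R1 \<union> R2 \<union> (C - {P c, p})"
    using theta_S2[OF A B C(1) S2s C(2) AB0 AC0 U[unfolded T] C(4)] by metis
  have cl: "closure R1 = R1 \<union> ((E a c \<union> La) \<union> C)" "closure R2 = R2 \<union> ((E b c \<union> Lb) \<union> C)"
    using component_closure[OF closed_curveI[OF A C(1) AC0(1)] _ R(1)]
      component_closure[OF closed_curveI[OF B C(1) AC0(2)] _ R(2)] S2s C(2) by auto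
  have UT: "U \<inter> tri a b c = {}" "closure U = U \<union> tri a b c" using triangle_component[OF v U] by auto
  have RU: "R1 \<inter> tri a b c = {}" "R2 \<inter> tri a b c = {}" using R(4) UT by auto
  have Rn: "R1 \<inter> C = {}" "R2 \<inter> C = {}" using in_components_subset[OF R(1)] in_components_subset[OF R(2)] by auto
  have "X \<subseteq> closure R1 \<union> closure R2" using X(2) UT(2) R(4) cl T by blast
  moreover have "closure R1 \<inter> closure R2 \<inter> X = {}"
  proof -
    have "R1 \<inter> (E b c \<union> Lb) = {}" "R2 \<inter> (E a c \<union> La) = {}" using RU unfolding T by blast+
    moreover have "(E a c \<union> La) \<inter> (E b c \<union> Lb) \<subseteq> C" using AB0 C(3) by blast
    ultimately have "closure R1 \<inter> closure R2 \<subseteq> C" unfolding cl using R(3) Rn by blast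
    then show ?thesis using X(3) by blast
  qed
  ultimately have "closure R1 \<inter> X = {} \<or> closure R2 \<inter> X = {}"
    using connected_closedD[OF X(1)] by (metis closed_closure)
  moreover have "closure R1 \<inter> X \<noteq> {}" using X(4) cl by blast
  ultimately have "closure R2 \<inter> X = {}" by blast
  then show "X \<inter> E b c \<subseteq> {}" using cl by blast
qed simp

lemma edge_subset_component:
  assumes "vs [a, b, c]" "U \<in> components (S2 - tri a b c)" "connected X" "X \<subseteq> S2" "X \<inter> tri a b c = {}" "X \<inter> U \<noteq> {}"
  shows "X \<subseteq> U"
  using components_maximal[OF assms(2,3)] assms by blast

text \<open>The chord is the part of \<open>cd\<close> between \<open>c\<close> and \<open>ab\<close>; the path \<open>adb\<close> would join its two sides.\<close>

lemma star_in_side_no_crossing: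
  assumes v: "vs [a, b, c, d]" and U: "U \<in> components (S2 - tri a b c)" and d: "P d \<in> U"
    and sub: "E a d \<subseteq> closure U" "E b d \<subseteq> closure U" "E c d \<subseteq> closure U"
  shows "E a b \<inter> E c d = {}"
proof (rule ccontr)
  assume "E a b \<inter> E c d \<noteq> {}"
  then obtain p where p: "p \<in> E a b" "p \<in> E c d" by blast
  have abc: "vs [a, b, c]" using v by auto
  have pne: "p \<noteq> P a" "p \<noteq> P b" "p \<noteq> P c" "p \<noteq> P d"
    using p P_notin_E[of c d a] P_notin_E[of c d b] P_notin_E[of a b c] P_notin_E[of a b d] v by auto
  obtain C M where C: "arc_between C (P c) p" "arc_between M p (P d)" "C \<union> M = E c d" "C \<inter> M = {p}"
    using arc_between_split[OF E_arc[of c d] p(2) pne(3,4)] v by auto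
  have dC: "P d \<notin> C" using C(4) pne(4) arc_between_ends[OF C(2)] by (metis IntI singletonD)
  have cd: "E c d \<inter> tri a b c \<subseteq> {P c, p}"
  proof -
    have "E c d \<inter> E a b \<subseteq> {p}" using E_meet_subset[OF v p] .
    then show ?thesis
      unfolding tri_def using E_inter'(3)[of c b d] E_inter'(3)[of c a d] v by auto
  qed
  have "P c \<in> tri a b c" "p \<in> tri a b c" using tri_vertices[OF abc] p unfolding tri_def by auto
  then have CT: "C \<inter> tri a b c = {P c, p}" using cd C(3) arc_between_ends[OF C(1)] by auto
  have Cs: "C \<subseteq> S2" using C(3) E_S2[of c d] v by auto
  have clU: "closure U = U \<union> tri a b c" using triangle_component[OF abc U] by auto
  have "C \<inter> U \<noteq> {}" using arc_between_interior(2)[OF C(1)] CT C(3) sub(3) clU by blast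
  define X where "X = E a d \<union> E b d"
  have con: "connected X"
    unfolding X_def using arc_between_connected[OF E_arc[of a d]] arc_between_connected[OF E_arc[of b d]]
      E_ends(2)[of a d] E_ends(2)[of b d] v by (intro connected_Un) auto
  have "X \<inter> E c d \<subseteq> {P d}" unfolding X_def using E_inter'(1)[of d a c] E_inter'(1)[of d b c] v by auto
  then have "X \<inter> C = {}" using dC C(3) by blast
  moreover have "X \<inter> E a c \<noteq> {}" "X \<inter> E b c \<noteq> {}"
    unfolding X_def using E_ends(1)[of a d] E_ends(1)[of a c] E_ends(1)[of b d] E_ends(1)[of b c] v by auto
  moreover have "X \<subseteq> closure U" unfolding X_def using sub by auto
  ultimately show False
    using chord_separates[OF abc U C(1) Cs CT \<open>C \<inter> U \<noteq> {}\<close> p(1) pne(1,2) con] by blast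
qed

lemma star_in_side_planar4:
  assumes v: "vs [a, b, c, d]" and U: "U \<in> components (S2 - tri a b c)" and d: "P d \<in> U"
    and sub: "E a d \<subseteq> closure U" "E b d \<subseteq> closure U" "E c d \<subseteq> closure U"
  shows "planar4 a b c d"
proof -
  have "E a b \<inter> E c d = {}" using star_in_side_no_crossing[of a b c d U] assms by auto
  moreover have "E a c \<inter> E b d = {}"
    using star_in_side_no_crossing[of a c b d U] assms tri_perm(2)[of a b c] by auto
  moreover have "E b c \<inter> E a d = {}"
    using star_in_side_no_crossing[of b c a d U] assms tri_perm(1)[of a b c] tri_perm(2)[of b a c] by auto
  ultimately show ?thesis unfolding planar4_def by auto
qed

text \<open>Apart from the choice of \<open>cside\<close>, convexity of the drawing enters only
  here: it keeps the edges at \<open>d\<close> in the closed side, as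
  \<open>star_in_side_planar4\<close> requires.\<close>

lemma convex_side_avoids_vertex:
  assumes v: "vs [a, b, c, d]" and "\<not> planar4 a b c d"
  shows "P d \<notin> closure (cside a b c)"
proof
  assume d: "P d \<in> closure (cside a b c)"
  have abc: "vs [a, b, c]" using v by auto
  note cs = cside[OF abc]
  have cl: "closure (cside a b c) = cside a b c \<union> tri a b c" using triangle_component[OF abc cs(1)] by auto
  then have "P d \<in> cside a b c" using d P_notin_tri[OF v] by auto
  moreover have "P a \<in> closure (cside a b c)" "P b \<in> closure (cside a b c)" "P c \<in> closure (cside a b c)"
    using tri_vertices[OF abc] cl by auto
  ultimately have "planar4 a b c d"
    using star_in_side_planar4[OF v cs(1)] cs(2)[of a d] cs(2)[of b d] cs(2)[of c d] d v by auto
  then show False using assms by auto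
qed

section \<open>Edges entering a side from outside\<close>

text \<open>If it did not meet \<open>ab\<close>, the edge \<open>cd\<close> without
  \<open>c\<close> would avoid the whole triangle and, being connected, remain in \<open>U\<close>
  up to \<open>d\<close>.\<close>

lemma entering_edge:
  assumes v: "vs [a, b, c, d]" and U: "U \<in> components (S2 - tri a b c)" and d: "P d \<notin> U"
    and cd: "E c d \<inter> U \<noteq> {}"
  obtains p where "p \<in> E a b" "p \<in> E c d"
proof -
  have "E a b \<inter> E c d \<noteq> {}"
  proof
    assume e: "E a b \<inter> E c d = {}"
    have abc: "vs [a, b, c]" using v by auto
    have "E c d \<inter> tri a b c \<subseteq> {P c}"
      unfolding tri_def using E_inter'(3)[of c b d] E_inter'(3)[of c a d] v e by auto
    moreover have "P c \<notin> U" using triangle_component(4)[OF abc U] tri_vertices[OF abc] by blast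
    moreover have "connected (E c d - {P c})"
      using arc_between_connected_sub[OF E_arc[of c d], of "E c d - {P c}"] v by auto
    ultimately have "E c d - {P c} \<subseteq> U"
      using edge_subset_component[OF abc U, of "E c d - {P c}"] cd E_S2[of c d] v by auto
    then show False using d E_ends(2)[of c d] P_eq[of c d] v by auto
  qed
  then show ?thesis using that by blast
qed

text \<open>Since \<open>cd\<close> meets the triangle only in \<open>c\<close> and
  \<open>p\<close>, the part \<open>L\<close> beyond \<open>p\<close> stays outside \<open>U\<close>
  together with \<open>d\<close>. So it is \<open>M\<close> that runs through \<open>U\<close>, and
  \<open>M\<close> can serve as the chord in \<open>chord_separates\<close>.\<close>

lemma entering_edge_part:
  assumes v: "vs [a, b, c, d]" and U: "U \<in> components (S2 - tri a b c)" and d: "P d \<notin> U"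
    and cd: "E c d \<inter> U \<noteq> {}" and p: "p \<in> E a b"
    and M: "arc_between M (P c) p" "arc_between L p (P d)" "M \<union> L = E c d" "M \<inter> L = {p}"
  shows "M - {P c, p} \<subseteq> U" "M \<inter> tri a b c = {P c, p}" "P d \<notin> M" "M \<subseteq> S2"
proof -
  have abc: "vs [a, b, c]" using v by auto
  have pcd: "p \<in> E c d" using M(3,4) by auto
  have pne: "p \<noteq> P c" "p \<noteq> P d" using arc_between_ends M(1,2) by blast+
  have cdT: "E c d \<inter> tri a b c \<subseteq> {P c, p}"
  proof -
    have "E c d \<inter> E a b \<subseteq> {p}" using E_meet_subset[OF v p pcd] .
    then show ?thesis
      unfolding tri_def using E_inter'(3)[of c b d] E_inter'(3)[of c a d] v by auto
  qed
  have PT: "P c \<in> tri a b c" "p \<in> tri a b c" using tri_vertices[OF abc] p unfolding tri_def by auto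
  then show MT: "M \<inter> tri a b c = {P c, p}" using cdT M(3) arc_between_ends[OF M(1)] by auto
  show dM: "P d \<notin> M" using M(4) pne(2) arc_between_ends[OF M(2)] by (metis IntI singletonD)
  have sub: "E c d \<subseteq> S2" using E_S2[of c d] v by auto
  then show "M \<subseteq> S2" using M(3) by blast
  have cL: "P c \<notin> L" using M(4) pne(1) arc_between_ends[OF M(1)] by (metis IntI singletonD)
  have UT: "U \<inter> tri a b c = {}" using triangle_component[OF abc U] by auto
  have "L - {p} \<subseteq> U" if "(L - {p}) \<inter> U \<noteq> {}"
  proof (rule edge_subset_component[OF abc U _ _ _ that])
    show "connected (L - {p})" by (rule arc_between_connected_sub[OF M(2)]) auto
    show "L - {p} \<subseteq> S2" using sub M(3) by blast
    show "(L - {p}) \<inter> tri a b c = {}" using cdT M(3) cL by blast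
  qed
  then have "(L - {p}) \<inter> U = {}" using d pne(2) arc_between_ends[OF M(2)] by blast
  then have "M \<inter> U \<noteq> {}" using cd M(3) PT(2) UT by blast
  then have "(M - {P c, p}) \<inter> U \<noteq> {}" using PT UT by blast
  then show "M - {P c, p} \<subseteq> U"
    using edge_subset_component[OF abc U arc_between_interior(1)[OF M(1)]] sub M(3) MT by blast
qed


section \<open>Nonplanarity of $K_5$\<close>

text \<open>The edge \<open>uv\<close> misses all three edges of the triangle.\<close>

lemma same_side_of_triangle:
  assumes v: "vs [x, y, z, u, v]" and pl: "planar4 x y u v" "planar4 y z u v" "planar4 x z u v"
    and U: "U \<in> components (S2 - tri x y z)" and u: "P u \<in> U"
  shows "P v \<in> U"
proof -
  have xyz: "vs [x, y, z]" using v by auto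
  have "E u v \<inter> tri x y z = {}" using pl unfolding tri_def planar4_def by blast
  moreover have "connected (E u v)" "E u v \<subseteq> S2" "P u \<in> E u v" "P v \<in> E u v"
    using arc_between_connected[OF E_arc[of u v]] E_S2[of u v] E_ends[of u v] v by auto
  ultimately show ?thesis
    using edge_subset_component[OF xyz U, of "E u v"] u by blast
qed

text \<open>The side of \<open>abc\<close> containing \<open>d\<close> also contains
  \<open>e\<close>. The path \<open>adc\<close> divides it into a side of \<open>adc\<close> and a
  side of the quadrilateral \<open>abcd\<close>, and \<open>bd\<close> divides the latter into sides
  of \<open>abd\<close> and \<open>dbc\<close>. Whichever of these triangles has \<open>e\<close> in
  its part, \<open>same_side_of_triangle\<close> would put the remaining one of \<open>a\<close>,
  \<open>b\<close>, \<open>c\<close> there too, although all three lie on the boundary of the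
  original side.\<close>

lemma K5_not_planar:
  assumes v: "vs [a, b, c, d, e]"
    and pl: "planar4 a b c d" "planar4 a b c e" "planar4 a b d e" "planar4 a c d e" "planar4 b c d e"
  shows False
proof -
  have abc: "vs [a, b, c]" and adc: "vs [a, d, c]" and abd: "vs [a, b, d]" and dbc: "vs [d, b, c]"
    using v by auto
  have d: "P d \<in> S2 - tri a b c" using P_S2[of d e] P_notin_tri[of a b c d] v by auto
  define U where "U = connected_component_set (S2 - tri a b c) (P d)"
  have U: "U \<in> components (S2 - tri a b c)" "P d \<in> U"
    unfolding U_def using d by (auto simp: components_def)
  note tU = triangle_component[OF abc U(1)]
  have e: "P e \<in> U"
    using same_side_of_triangle[of a b c d e U] v pl U by auto
  have bU: "P a \<notin> U" "P b \<notin> U" "P c \<notin> U" using tri_vertices[OF abc] tU(4) by blast+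
  define Q where "Q = E a b \<union> E b c \<union> (E a d \<union> E d c)"
  have i: "E a b \<inter> E c d = {}" "E a c \<inter> E b d = {}" "E a d \<inter> E b c = {}"
    using pl(1) unfolding planar4_def by auto
  have AC: "E a c \<inter> (E a d \<union> E d c) = {P a, P c}" "(E a b \<union> E b c) \<inter> (E a d \<union> E d c) = {P a, P c}"
    "E a c \<inter> (E a b \<union> E b c) = {P a, P c}"
    using E_inter[of a c d] E_inter'(1)[of c a d] E_inter[of a b d] E_inter'(1)[of c b d] E_inter[of a c b]
      E_inter'(1)[of c a b] i E_commute[of c d] v by auto
  have AB: "E a c \<union> (E a b \<union> E b c) = tri a b c" "E a c \<union> (E a d \<union> E d c) = tri a d c"
    unfolding tri_def by auto
  have s: "E a c \<subseteq> S2" "E a b \<union> E b c \<subseteq> S2" "E a d \<union> E d c \<subseteq> S2" "E b d \<subseteq> S2"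
    using E_S2 v by auto
  have CU: "(E a d \<union> E d c) \<inter> U \<noteq> {}" using U(2) E_ends(2)[of a d] v by auto
  have arc_ac: "arc_between (E a c) (P a) (P c)" using E_arc v by auto
  obtain R1 R2 where R: "R1 \<in> components (S2 - tri a d c)" "R2 \<in> components (S2 - Q)"
    "R1 \<inter> R2 = {}" "U = R1 \<union> R2 \<union> (E a d \<union> E d c - {P a, P c})"
    using theta_S2[OF arc_ac two_arc[OF abc] two_arc[OF adc] s(1,2,3) AC(3,1,2), unfolded AB, OF U(1) CU]
    unfolding Q_def by metis
  have eC: "P e \<notin> E a d \<union> E d c" using P_notin_E[of a d e] P_notin_E[of d c e] v by auto
  have eR1: "P e \<notin> R1"
  proof
    assume "P e \<in> R1"
    then have "P b \<in> R1"
      using same_side_of_triangle[of a d c e b R1] R(1) v pl planar4_perm by auto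
    then show False using R(4) bU by blast
  qed
  then have eR2: "P e \<in> R2" using e R(4) eC by blast
  have bdT: "E b d \<inter> tri a b c \<subseteq> {P b}"
    unfolding tri_def using i E_inter[of b d a] E_inter[of b d c] E_commute[of a b] v by auto
  have bdT': "E b d \<inter> tri a d c \<subseteq> {P d}"
  proof -
    have "E b d \<inter> E a d = {P d}" "E b d \<inter> E d c = {P d}"
      using E_inter'(1)[of d b a] E_inter'(3)[of d b c] v by auto
    then show ?thesis unfolding tri_def using i(2) by blast
  qed
  have arc_bd: "arc_between (E b d) (P b) (P d)" using E_arc v by auto
  have "E b d - {P b} \<subseteq> U"
  proof (rule edge_subset_component[OF abc U(1)])
    show "connected (E b d - {P b})" by (rule arc_between_connected_sub[OF arc_bd]) auto
    show "(E b d - {P b}) \<inter> U \<noteq> {}" using U(2) E_ends(2)[of b d] P_eq[of b d] v by auto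
  qed (use s bdT in auto)
  then have bd: "E b d - {P b, P d} \<subseteq> R1 \<union> R2"
    using R(4) bdT' unfolding tri_def by blast
  \<comment> \<open>Otherwise \<open>bd\<close> without \<open>d\<close>, which avoids the triangle
    \<open>adc\<close>, would lie in \<open>R1\<close> together with \<open>b\<close>. So it is
    \<open>R2\<close> that \<open>bd\<close> divides.\<close>
  have "(E b d - {P d}) \<inter> R1 = {}"
  proof (rule ccontr)
    assume "(E b d - {P d}) \<inter> R1 \<noteq> {}"
    then have "E b d - {P d} \<subseteq> R1"
    proof (rule edge_subset_component[OF adc R(1), rotated -1])
      show "connected (E b d - {P d})" by (rule arc_between_connected_sub[OF arc_bd]) auto
    qed (use s bdT' in auto)
    then have "P b \<in> R1" using E_ends(1)[of b d] P_eq[of b d] v by auto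
    then show False using R(4) bU by blast
  qed
  then have DR2: "E b d \<inter> R2 \<noteq> {}" using bd arc_between_interior(2)[OF arc_bd] by blast
  have A2: "arc_between (E b a \<union> E a d) (P b) (P d)" "arc_between (E b c \<union> E c d) (P b) (P d)"
    using two_arc[of b a d] two_arc[of b c d] v by auto
  have Q2: "(E b a \<union> E a d) \<union> (E b c \<union> E c d) = Q" "(E b a \<union> E a d) \<union> E b d = tri a b d"
    "(E b c \<union> E c d) \<union> E b d = tri d b c"
    unfolding Q_def tri_def using E_commute[of a b] E_commute[of c d] E_commute[of b d] by auto
  have I2: "(E b a \<union> E a d) \<inter> (E b c \<union> E c d) = {P b, P d}" "(E b a \<union> E a d) \<inter> E b d = {P b, P d}"
    "(E b c \<union> E c d) \<inter> E b d = {P b, P d}"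
    using E_inter[of b a c] E_inter'(1)[of d a c] E_inter[of b a d] E_inter'(1)[of d a b] E_inter[of b c d]
      E_inter'(1)[of d c b] i E_commute[of a b] v by auto
  have s2: "E b a \<union> E a d \<subseteq> S2" "E b c \<union> E c d \<subseteq> S2" using E_S2 v by auto
  obtain R3 R4 where R': "R3 \<in> components (S2 - tri a b d)" "R4 \<in> components (S2 - tri d b c)"
    "R2 = R3 \<union> R4 \<union> (E b d - {P b, P d})"
    using theta_S2[OF A2 arc_bd s2 s(4) I2, unfolded Q2, OF R(2) DR2] by metis
  have "P e \<notin> E b d" using P_notin_E[of b d e] v by auto
  then consider "P e \<in> R3" | "P e \<in> R4" using eR2 R'(3) by blast
  then show False
  proof cases
    case 1
    then have "P c \<in> R3"
      using same_side_of_triangle[of a b d e c R3] R'(1) v pl planar4_perm by auto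
    then show ?thesis using R(4) R'(3) bU by blast
  next
    case 2
    then have "P a \<in> R4"
      using same_side_of_triangle[of d b c e a R4] R'(2) v pl planar4_perm by auto
    then show ?thesis using R(4) R'(3) bU by blast
  qed
qed

section \<open>Crossing pairs\<close>

text \<open>The edge \<open>cd\<close> crosses \<open>ab\<close> on its way from \<open>d\<close> into the convex side of \<open>abc\<close>. Unlike mere
  intersection of the two edges, this excludes tangency.\<close>

definition cross :: "'v \<Rightarrow> 'v \<Rightarrow> 'v \<Rightarrow> 'v \<Rightarrow> bool" where
  "cross a b c d \<longleftrightarrow> E c d \<inter> cside a b c \<noteq> {}"

lemma cross_swap_left: "cross a b c d = cross b a c d"
  unfolding cross_def using cside_perm by simp

lemma cside_vertex:
  assumes "vs [a, b, c, d]" "\<not> planar4 a b c d"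
  shows "P d \<notin> cside a b c"
  using convex_side_avoids_vertex[OF assms] closure_subset by blast

lemma cross_meet:
  assumes v: "vs [a, b, c, d]" and np: "\<not> planar4 a b c d" and cr: "cross a b c d"
  obtains p where "p \<in> E a b" "p \<in> E c d"
  using entering_edge[OF v cside(1) cside_vertex[OF v np]] cr v unfolding cross_def by auto

lemma cross_part:
  assumes v: "vs [a, b, c, d]" and np: "\<not> planar4 a b c d" and cr: "cross a b c d" and p: "p \<in> E a b"
    and M: "arc_between M (P c) p" "arc_between L p (P d)" "M \<union> L = E c d" "M \<inter> L = {p}"
  shows "M - {P c, p} \<subseteq> cside a b c" "M \<inter> tri a b c = {P c, p}" "P d \<notin> M" "M \<subseteq> S2"
proof -
  have abc: "vs [a, b, c]" using v by auto
  note e = entering_edge_part[OF v cside(1)[OF abc] cside_vertex[OF v np] cr[unfolded cross_def] p M]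
  show "M - {P c, p} \<subseteq> cside a b c" "M \<inter> tri a b c = {P c, p}" "P d \<notin> M" "M \<subseteq> S2"
    using e by auto
qed

text \<open>The part \<open>N\<close> of \<open>bd\<close> from \<open>b\<close> to
  \<open>ac\<close> is a chord of the side. The part \<open>M\<close> of \<open>cd\<close> from
  \<open>c\<close> to \<open>ab\<close> avoids it, because \<open>bd\<close> and \<open>cd\<close>
  share only \<open>d\<close>; but \<open>M\<close> joins \<open>ab\<close> to \<open>c\<close>,
  against \<open>chord_separates\<close>.\<close>

lemma cross_unique:
  assumes v: "vs [a, b, c, d]" and np: "\<not> planar4 a b c d" and cr: "cross a b c d" "cross a c b d"
  shows False
proof -
  have abc: "vs [a, b, c]" and v': "vs [a, c, b, d]" using v by auto
  have np': "\<not> planar4 a c b d" using np planar4_perm by metis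
  obtain p where p: "p \<in> E a b" "p \<in> E c d" using cross_meet[OF v np cr(1)] by metis
  obtain q where q: "q \<in> E a c" "q \<in> E b d" using cross_meet[OF v' np' cr(2)] by metis
  have pne: "p \<noteq> P a" "p \<noteq> P b" "p \<noteq> P c" "p \<noteq> P d"
    using p P_notin_E[of c d a] P_notin_E[of c d b] P_notin_E[of a b c] P_notin_E[of a b d] v by auto
  have qne: "q \<noteq> P a" "q \<noteq> P b" "q \<noteq> P c" "q \<noteq> P d"
    using q P_notin_E[of b d a] P_notin_E[of b d c] P_notin_E[of a c b] P_notin_E[of a c d] v by auto
  obtain M L where M: "arc_between M (P c) p" "arc_between L p (P d)" "M \<union> L = E c d" "M \<inter> L = {p}"
    using arc_between_split[OF E_arc[of c d] p(2) pne(3,4)] v by auto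
  obtain N K where N: "arc_between N (P b) q" "arc_between K q (P d)" "N \<union> K = E b d" "N \<inter> K = {q}"
    using arc_between_split[OF E_arc[of b d] q(2) qne(2,4)] v by auto
  note cM = cross_part[OF v np cr(1) p(1) M] and cN = cross_part[OF v' np' cr(2) q(1) N]
  have cs: "cside a c b \<in> components (S2 - tri a c b)" using cside(1) v by auto
  have acb: "vs [a, c, b]" using v by auto
  have clU: "closure (cside a c b) = cside a c b \<union> tri a c b" using triangle_component[OF acb cs] by auto
  have Mcl: "M \<subseteq> closure (cside a c b)"
    using cM(1,2) clU cside_perm(2)[of a b c] tri_perm(2)[of a b c] by blast
  have "M \<inter> N \<subseteq> E c d \<inter> E b d" using M(3) N(3) by blast
  also have "\<dots> = {P d}" using E_inter'(1)[of d c b] v by auto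
  finally have MN: "M \<inter> N = {}" using cM(3) by blast
  have Nne: "N \<inter> cside a c b \<noteq> {}" using cN(1) arc_between_interior(2)[OF N(1)] by blast
  have "M \<inter> E a b \<noteq> {}" using p(1) arc_between_ends[OF M(1)] by blast
  then have "M \<inter> E c b = {}"
    using chord_separates[OF acb cs N(1) cN(4) cN(2) Nne q(1) qne(1,3) arc_between_connected[OF M(1)] Mcl MN]
    by simp
  then show False using E_ends(1)[of c b] arc_between_ends[OF M(1)] v by auto
qed

text \<open>If no edge at \<open>d\<close> enters the convex side, all three run in the closure of
  the opposite side \<open>U\<close>, which contains \<open>d\<close>. As
  \<open>star_in_side_planar4\<close> speaks of an arbitrary side, it applies to
  \<open>U\<close>.\<close>

lemma cross_exists_at:
  assumes v: "vs [a, b, c, d]" and np: "\<not> planar4 a b c d"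
  shows "cross a b c d \<or> cross a c b d \<or> cross b c a d"
proof (rule ccontr)
  assume n: "\<not> (cross a b c d \<or> cross a c b d \<or> cross b c a d)"
  have abc: "vs [a, b, c]" using v by auto
  obtain U where U: "jordan_sides (tri a b c) (cside a b c) U" "U \<in> components (S2 - tri a b c)"
    using component_other_side[OF closed_curve_tri[OF abc] tri_S2[OF abc] cside(1)[OF abc]] by metis
  have un: "cside a b c \<union> U = S2 - tri a b c" using U(1) unfolding jordan_sides_def by blast
  have clU: "closure U = U \<union> tri a b c" using triangle_component[OF abc U(2)] by auto
  have "P d \<in> S2" using P_S2[of d a] v by auto
  then have d: "P d \<in> U" using un cside_vertex[OF v np] P_notin_tri[OF v] by blast
  have "E c d \<inter> cside a b c = {}" "E b d \<inter> cside a b c = {}" "E a d \<inter> cside a b c = {}"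
    using n unfolding cross_def using cside_perm by metis+
  moreover have "E c d \<subseteq> S2" "E b d \<subseteq> S2" "E a d \<subseteq> S2" using E_S2 v by auto
  ultimately have "E c d \<subseteq> closure U \<and> E b d \<subseteq> closure U \<and> E a d \<subseteq> closure U"
    unfolding clU using un by blast
  then show False using star_in_side_planar4[OF v U(2) d] np by blast
qed

text \<open>If \<open>cd\<close> did not enter the side of \<open>abd\<close>, then by
  \<open>cross_exists_at\<close> one of \<open>ac\<close>, \<open>bc\<close> would. By
  \<open>cross_unique\<close> the triangle \<open>abd\<close> misses the open side of
  \<open>abc\<close>, so this side lies within that of \<open>abd\<close> or is disjoint from it.
  The former would put \<open>c\<close> into the closed side of \<open>abd\<close>. The latter fails
  because \<open>ac\<close> and \<open>bc\<close> lie on the boundary of the one side, while one of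
  them enters the other, which is open.\<close>

lemma cross_swap_right:
  assumes v: "vs [a, b, c, d]" and np: "\<not> planar4 a b c d" and cr: "cross a b c d"
  shows "cross a b d c"
proof (rule ccontr)
  assume n: "\<not> cross a b d c"
  have v': "vs [a, b, d, c]" and np': "\<not> planar4 a b d c" and abc: "vs [a, b, c]" and abd: "vs [a, b, d]"
    using v np planar4_perm by auto
  have "cross a d b c \<or> cross b d a c" using cross_exists_at[OF v' np'] n by auto
  then obtain z where z: "z = a \<or> z = b" "E z c \<inter> cside a b d \<noteq> {}"
    unfolding cross_def using cside_perm by metis
  have u: "\<not> cross a c b d" "\<not> cross b c a d"
    using cross_unique[OF v np cr] cross_unique[of b a c d] cross_swap_left[of a b c d] v np cr planar4_perm by auto
  then have "E b d \<inter> cside a b c = {}" "E a d \<inter> cside a b c = {}"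
    unfolding cross_def using cside_perm by metis+
  moreover have W: "cside a b c \<in> components (S2 - tri a b c)" "cside a b d \<in> components (S2 - tri a b d)"
    using cside(1) v by auto
  note tW = triangle_component[OF abc W(1)] and tW' = triangle_component[OF abd W(2)]
  ultimately have disjT: "cside a b c \<inter> tri a b d = {}"
    using tW(4) unfolding tri_def by blast
  have "cside a b c \<inter> cside a b d = {}"
  proof (rule ccontr)
    assume "cside a b c \<inter> cside a b d \<noteq> {}"
    then have "cside a b c \<subseteq> cside a b d"
      using edge_subset_component[OF abd W(2) tW(5) tW(3) disjT] by auto
    then have "closure (cside a b c) \<subseteq> closure (cside a b d)" by (rule closure_mono)
    then have "P c \<in> closure (cside a b d)" using tri_vertices(3)[OF abc] tW(1) by blast
    then show False using convex_side_avoids_vertex[OF v' np'] by simp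
  qed
  moreover obtain B where B: "open B" "cside a b d = S2 \<inter> B" using tW'(2) by (metis openin_open)
  moreover have "E z c \<subseteq> closure (cside a b c)"
    using z(1) tW(1) E_commute unfolding tri_def by blast
  then have "B \<inter> closure (cside a b c) \<noteq> {}" using z(2) B(2) by blast
  then have "B \<inter> cside a b c \<noteq> {}" using open_Int_closure_eq_empty[OF B(1)] by metis
  then have "cside a b d \<inter> cside a b c \<noteq> {}" using B(2) tW(3) by blast
  ultimately show False by blast
qed

text \<open>By elimination: at the triangle \<open>acd\<close>, the two other crossings offered by
  \<open>cross_exists_at\<close> are carried by \<open>cross_swap_right\<close> to ones that
  \<open>cross_unique\<close> excludes.\<close>

lemma cross_swap_pairs:
  assumes v: "vs [a, b, c, d]" and np: "\<not> planar4 a b c d" and cr: "cross a b c d"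
  shows "cross c d a b"
proof (rule ccontr)
  assume n: "\<not> cross c d a b"
  have v': "vs [a, c, d, b]" "vs [c, a, d, b]" and np': "\<not> planar4 a c d b" "\<not> planar4 a d c b"
    using v np planar4_perm by auto
  have u: "\<not> cross a c b d" "\<not> cross b c a d"
    using cross_unique[OF v np cr] cross_unique[of b a c d] cross_swap_left[of a b c d] v np cr planar4_perm by auto
  have "cross a c d b \<or> cross a d c b"
    using cross_exists_at[OF v'(1) np'(1)] n by auto
  then show False
  proof
    assume "cross a c d b"
    then have "cross a c b d" using cross_swap_right[OF v'(1) np'(1)] by simp
    then show False using u by simp
  next
    assume 1: "cross a d c b"
    then have "cross a d b c" using cross_swap_right[of a d c b] v np'(2) by auto
    moreover have "cross a b d c" using cross_swap_right[OF v np cr] .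
    ultimately show False using cross_unique[of a b d c] v np planar4_perm by auto
  qed
qed


text \<open>\<open>cross_unique\<close> compares crossings seen from one triangle;
  \<open>cross_swap_right\<close> moves them to a common one where necessary.\<close>

lemma cross_exclusive:
  assumes v: "vs [a, b, c, d]" and np: "\<not> planar4 a b c d"
  shows "\<not> (cross a b c d \<and> cross a c b d)" "\<not> (cross a b c d \<and> cross a d b c)"
    "\<not> (cross a c b d \<and> cross a d b c)"
proof -
  have v': "vs [a, b, d, c]" "vs [a, c, b, d]" "vs [a, c, d, b]" "vs [a, d, b, c]" using v by auto
  have np': "\<not> planar4 a b d c" "\<not> planar4 a c b d" "\<not> planar4 a c d b" "\<not> planar4 a d b c"
    using np planar4_perm by metis+
  show "\<not> (cross a b c d \<and> cross a c b d)" using cross_unique[OF v np] by blast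
  show "\<not> (cross a b c d \<and> cross a d b c)"
    using cross_unique[OF v'(1) np'(1)] cross_swap_right[OF v np] by blast
  show "\<not> (cross a c b d \<and> cross a d b c)"
    using cross_unique[OF v'(3) np'(3)] cross_swap_right[OF v'(2) np'(2)] cross_swap_right[OF v'(4) np'(4)] by blast
qed

lemma cross_exists:
  assumes v: "vs [a, b, c, d]" and np: "\<not> planar4 a b c d"
  shows "cross a b c d \<or> cross a c b d \<or> cross a d b c"
proof -
  have "vs [b, c, a, d]" "\<not> planar4 b c a d" using v np planar4_perm by auto
  then show ?thesis using cross_exists_at[OF v np] cross_swap_pairs[of b c a d] by blast
qed

text \<open>Minus its crossing point with \<open>km\<close>, the edge \<open>ij\<close> lies inside the convex sides of \<open>kmi\<close> and
  \<open>kmj\<close>, so an edge \<open>kl\<close> that merely touches \<open>ij\<close> already enters one of them.\<close>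

lemma cross_of_touching:
  assumes v: "vs [i, j, m, k, l]" and np: "\<not> planar4 i j m k" and cr: "cross i j m k"
    and meet: "E k l \<inter> E i j \<noteq> {}"
  shows "cross m i k l \<or> cross m j k l"
proof -
  have v0: "vs [i, j, m, k]" and v1: "vs [m, k, i, j]" and v2: "vs [m, k, j, i]" using v by auto
  have np1: "\<not> planar4 m k i j" and np2: "\<not> planar4 m k j i" using np planar4_perm by metis+
  have c1: "cross m k i j" using cross_swap_pairs[OF v0 np cr] .
  have c2: "cross m k j i" using cross_swap_right[OF v1 np1 c1] .
  obtain p where p: "p \<in> E m k" "p \<in> E i j" using cross_meet[OF v1 np1 c1] by metis
  have pne: "p \<noteq> P i" "p \<noteq> P j" "p \<noteq> P k"
    using p P_notin_E[of m k i] P_notin_E[of m k j] P_notin_E[of i j k] v by auto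
  obtain M L where M: "arc_between M (P i) p" "arc_between L p (P j)" "M \<union> L = E i j" "M \<inter> L = {p}"
    using arc_between_split[OF E_arc[of i j] p(2) pne(1,2)] v by auto
  have "L \<union> M = E j i" "L \<inter> M = {p}" using M E_commute by blast+
  then have sub: "M - {P i, p} \<subseteq> cside m k i" "L - {P j, p} \<subseteq> cside m k j"
    using cross_part(1)[OF v1 np1 c1 p(1) M] cross_part(1)[OF v2 np2 c2 p(1) arc_between_sym[OF M(2)] arc_between_sym[OF M(1)]]
    by auto
  obtain t where t: "t \<in> E k l" "t \<in> E i j" using meet by blast
  have "E m k \<inter> E k l = {P k}" using E_inter'(3)[of k m l] v by auto
  then have "t \<noteq> p" using t(1) p(1) pne(3) by blast
  moreover have "t \<noteq> P i" "t \<noteq> P j" using t(1) P_notin_E[of k l i] P_notin_E[of k l j] v by auto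
  ultimately have "t \<in> cside m k i \<or> t \<in> cside m k j" using t(2) M(3) sub by blast
  then show ?thesis
    unfolding cross_def using t(1) cside_perm(2)[of m k i] cside_perm(2)[of m k j] by auto
qed

text \<open>In the next four lemmas the vertices are listed in the order of the Ramsey argument. For
  \<open>i < j < k < l\<close> the three patterns are \<open>ij\<close> across \<open>kl\<close>, \<open>il\<close> across \<open>jk\<close>, and \<open>ik\<close> across
  \<open>jl\<close>; only the last one survives, and its other two pairs do not even touch.\<close>

lemma cross_pattern_adjacent_impossible:
  assumes v: "vs [a, b, c, d, e]"
    and np: "\<not> planar4 a b c d" "\<not> planar4 a b c e" "\<not> planar4 a c d e" "\<not> planar4 b c d e"
    and cr: "cross a b c d" "cross a b c e" "cross a c d e" "cross b c d e"
  shows False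
proof -
  have "\<not> planar4 a b d c" "cross a b d c" using np(1) planar4_perm cross_swap_right[of a b c d] v cr(1) by auto
  \<comment> \<open>As \<open>ce\<close> meets \<open>ab\<close>, which crosses \<open>dc\<close>,
    it has to cross \<open>da\<close> or \<open>db\<close>. But in \<open>acde\<close> and
    \<open>bcde\<close> the edge that crosses \<open>ac\<close>, respectively \<open>bc\<close>, is
    \<open>de\<close>.\<close>
  moreover have "E c e \<inter> E a b \<noteq> {}" using cross_meet[of a b c e] v np(2) cr(2) by auto
  ultimately have "cross d a c e \<or> cross d b c e" using cross_of_touching[of a b d c e] v by auto
  then have "cross a d c e \<or> cross b d c e" using cross_swap_left by blast
  then show False using cross_exclusive(1)[of a c d e] cross_exclusive(1)[of b c d e] v np cr by auto
qed

lemma cross_pattern_nested_impossible: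
  assumes v: "vs [a, b, c, d, e]"
    and np: "\<not> planar4 a b c e" "\<not> planar4 a b c d" "\<not> planar4 a b d e" "\<not> planar4 a c d e"
    and cr: "cross a e b c" "cross a d b c" "cross a e b d" "cross a e c d"
  shows False
proof -
  have np': "\<not> planar4 a e b c" "\<not> planar4 b c a e" "\<not> planar4 b c e a" "\<not> planar4 a d b c"
    "\<not> planar4 b e a d" "\<not> planar4 c e a d"
    using np planar4_perm by metis+
  have "cross b c a e" using cross_swap_pairs[of a e b c] v np' cr by auto
  then have "cross b c e a" using cross_swap_right[of b c a e] v np' by auto
  \<comment> \<open>As \<open>ad\<close> meets \<open>bc\<close>, which crosses \<open>ea\<close>,
    it has to cross \<open>eb\<close> or \<open>ec\<close>. But in \<open>abde\<close> and
    \<open>acde\<close> it is \<open>ae\<close> that crosses \<open>bd\<close>, respectively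
    \<open>cd\<close>.\<close>
  moreover have "E a d \<inter> E b c \<noteq> {}" using cross_meet[of a d b c] v np' cr(2) by auto
  ultimately have "cross e b a d \<or> cross e c a d" using cross_of_touching[of b c e a d] v np' by auto
  then have "cross a d b e \<or> cross a d c e"
    using cross_swap_left cross_swap_pairs[of b e a d] cross_swap_pairs[of c e a d] np' v by auto
  then show False using cross_exclusive(3)[of a b d e] cross_exclusive(3)[of a c d e] v np cr by auto
qed

lemma alternating_no_adjacent_touching:
  assumes v: "vs [i, m, j, k, l]"
    and np: "\<not> planar4 i m j k" "\<not> planar4 i m k l" "\<not> planar4 m j k l"
    and cr: "cross i j m k" "cross i k m l" "cross m k j l"
  shows "E i j \<inter> E k l = {}"
proof (rule ccontr)
  assume "E i j \<inter> E k l \<noteq> {}"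
  moreover have "\<not> planar4 i j m k" using np(1) planar4_perm by metis
  \<comment> \<open>So \<open>kl\<close> would cross \<open>mi\<close> or \<open>mj\<close>, while
    the crossing pairs are \<open>ik\<close>, \<open>ml\<close> in \<open>imkl\<close> and
    \<open>mk\<close>, \<open>jl\<close> in \<open>mjkl\<close>.\<close>
  ultimately have "cross m i k l \<or> cross m j k l" using cross_of_touching[of i j m k l] v cr by auto
  then show False
    using cross_exclusive(1)[of i m k l] cross_exclusive(1)[of m j k l] cross_swap_left[of m i] v np cr by auto
qed

lemma alternating_no_nested_touching:
  assumes v: "vs [i, j, m, k, l]"
    and np: "\<not> planar4 j m k l" "\<not> planar4 i j m l" "\<not> planar4 i m k l"
    and cr: "cross j k m l" "cross i m j l" "cross i k m l"
  shows "E i l \<inter> E j k = {}"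
proof (rule ccontr)
  assume "E i l \<inter> E j k \<noteq> {}"
  then have "E l i \<inter> E j k \<noteq> {}" using E_commute by metis
  moreover have np': "\<not> planar4 j k m l" "\<not> planar4 m j l i" "\<not> planar4 m k l i" using np planar4_perm by metis+
  \<comment> \<open>So \<open>li\<close> would cross \<open>mj\<close> or \<open>mk\<close>, while
    the crossing pairs are \<open>im\<close>, \<open>jl\<close> in \<open>ijml\<close> and
    \<open>ik\<close>, \<open>ml\<close> in \<open>imkl\<close>.\<close>
  ultimately have "cross m j l i \<or> cross m k l i" using cross_of_touching[of j k m l i] v cr by auto
  then have "cross l i m j \<or> cross l i m k"
    using cross_swap_pairs[of m j l i] cross_swap_pairs[of m k l i] np' v by auto
  then have "cross i l j m \<or> cross i l m k"
  proof
    assume c: "cross l i m j"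
    have "\<not> planar4 i l m j" using np(2) planar4_perm by metis
    then show ?thesis using cross_swap_right[of i l m j] c cross_swap_left v by auto
  qed (use cross_swap_left in auto)
  then show False
    using cross_exclusive(3)[of i j m l] cross_exclusive(3)[of i m k l] v np cr by auto
qed

section \<open>Vertices in convex position\<close>

text \<open>Plain intersection is enough: the tangencies are gone, and the study of the cycle never
  refers to \<open>cross\<close>.\<close>

definition convex_position :: "nat \<Rightarrow> (nat \<Rightarrow> 'v) \<Rightarrow> bool" where
  "convex_position r v \<longleftrightarrow> inj_on v {..<r} \<and> v ` {..<r} \<subseteq> V \<and>
    (\<forall>i j k l. i < j \<longrightarrow> j < k \<longrightarrow> k < l \<longrightarrow> l < r \<longrightarrow>
      E (v i) (v k) \<inter> E (v j) (v l) \<noteq> {} \<and> E (v i) (v j) \<inter> E (v k) (v l) = {} \<and>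
      E (v i) (v l) \<inter> E (v j) (v k) = {})"

lemma convex_position_of_alternating:
  assumes inj: "inj_on h {..<2 * r}" and V: "h ` {..<2 * r} \<subseteq> V"
    and alt: "\<And>i j k l. \<lbrakk>i < j; j < k; k < l; l < 2 * r\<rbrakk> \<Longrightarrow>
      \<not> planar4 (h i) (h j) (h k) (h l) \<and> cross (h i) (h k) (h j) (h l)"
  shows "convex_position r (\<lambda>i. h (2 * i))"
proof -
  have d: "vs (map h xs)" if "distinct xs" "\<forall>x\<in>set xs. x < 2 * r" for xs
  proof -
    have "inj_on h (set xs)" by (rule inj_on_subset[OF inj]) (use that in auto)
    then show ?thesis using that V by (auto simp: distinct_map)
  qed
  have "E (h (2*i)) (h (2*k)) \<inter> E (h (2*j)) (h (2*l)) \<noteq> {} \<and> E (h (2*i)) (h (2*j)) \<inter> E (h (2*k)) (h (2*l)) = {} \<and>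
      E (h (2*i)) (h (2*l)) \<inter> E (h (2*j)) (h (2*k)) = {}"
    if ijkl: "i < j" "j < k" "k < l" "l < r" for i j k l
  proof (intro conjI)
    \<comment> \<open>The odd indices \<open>2*i+1\<close>, between \<open>2*i\<close> and
      \<open>2*j\<close>, and \<open>2*j+1\<close>, between \<open>2*j\<close> and
      \<open>2*k\<close>, supply the vertex \<open>m\<close> of the two touching lemmas.\<close>
    have o: "2*i < 2*i+1" "2*i+1 < 2*j" "2*j < 2*j+1" "2*j+1 < 2*k" "2*k < 2*l" "2*l < 2*r" using ijkl by auto
    have "\<not> planar4 (h (2*i)) (h (2*k)) (h (2*j)) (h (2*l))" "cross (h (2*i)) (h (2*k)) (h (2*j)) (h (2*l))"
      using alt[of "2*i" "2*j" "2*k" "2*l"] planar4_perm(2) o by auto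
    then show "E (h (2*i)) (h (2*k)) \<inter> E (h (2*j)) (h (2*l)) \<noteq> {}"
      using cross_meet[of "h (2*i)" "h (2*k)" "h (2*j)" "h (2*l)"] d[of "[2*i, 2*k, 2*j, 2*l]"] o by auto
    show "E (h (2*i)) (h (2*j)) \<inter> E (h (2*k)) (h (2*l)) = {}"
      by (rule alternating_no_adjacent_touching[of "h (2*i)" "h (2*i+1)" "h (2*j)" "h (2*k)" "h (2*l)"])
        (use d[of "[2*i, 2*i+1, 2*j, 2*k, 2*l]"] alt o in auto)
    show "E (h (2*i)) (h (2*l)) \<inter> E (h (2*j)) (h (2*k)) = {}"
      by (rule alternating_no_nested_touching[of "h (2*i)" "h (2*j)" "h (2*j+1)" "h (2*k)" "h (2*l)"])
        (use d[of "[2*i, 2*j, 2*j+1, 2*k, 2*l]"] alt o in auto)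
  qed
  moreover have "inj_on (\<lambda>i. h (2 * i)) {..<r}"
    by (intro inj_onI) (use inj_onD[OF inj, of "2 * _" "2 * _"] in force)
  moreover have "(\<lambda>i. h (2 * i)) ` {..<r} \<subseteq> V" using V by auto
  ultimately show ?thesis unfolding convex_position_def by blast
qed

section \<open>The cycle through consecutive vertices\<close>

definition hull_cycle :: "nat \<Rightarrow> (nat \<Rightarrow> 'v) \<Rightarrow> (real^3) set" where
  "hull_cycle r v = (\<Union>i<r. E (v i) (v (Suc i mod r)))"

lemma hull_cycle_edge: "i < r \<Longrightarrow> E (v i) (v (Suc i mod r)) \<subseteq> hull_cycle r v"
  unfolding hull_cycle_def by blast

text \<open>The path and the edge that closes it are the two arcs required by
  \<open>closed_curve\<close>.\<close>

lemma hull_cycle_eq: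
  assumes "r > 0"
  shows "hull_cycle (Suc r) v = (\<Union>i<r. E (v i) (v (Suc i))) \<union> E (v 0) (v r)"
proof -
  have "E (v i) (v (Suc i mod Suc r)) = E (v i) (v (Suc i))" if "i < r" for i using that by simp
  then show ?thesis
    unfolding hull_cycle_def lessThan_Suc using assms E_commute[of "v 0" "v r"] by auto
qed

context
  fixes r :: nat and v :: "nat \<Rightarrow> 'v"
  assumes cp: "convex_position r v"
begin

lemma cp_vs: "\<lbrakk>distinct xs; \<forall>x\<in>set xs. x < r\<rbrakk> \<Longrightarrow> vs (map v xs)"
  using cp unfolding convex_position_def
  by (auto simp: distinct_map intro: inj_on_subset[of v "{..<r}"])

lemma cp_vs2: "\<lbrakk>i < r; j < r; i \<noteq> j\<rbrakk> \<Longrightarrow> vs [v i, v j]"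
  using cp_vs[of "[i, j]"] by simp

lemma cp_vs3: "\<lbrakk>i < r; j < r; k < r; distinct [i, j, k]\<rbrakk> \<Longrightarrow> vs [v i, v j, v k]"
  using cp_vs[of "[i, j, k]"] by simp

lemma cp_cross: "\<lbrakk>i < j; j < k; k < l; l < r\<rbrakk> \<Longrightarrow> E (v i) (v k) \<inter> E (v j) (v l) \<noteq> {}"
  and cp_adjacent: "\<lbrakk>i < j; j < k; k < l; l < r\<rbrakk> \<Longrightarrow> E (v i) (v j) \<inter> E (v k) (v l) = {}"
  and cp_nested: "\<lbrakk>i < j; j < k; k < l; l < r\<rbrakk> \<Longrightarrow> E (v i) (v l) \<inter> E (v j) (v k) = {}"
  using cp unfolding convex_position_def by blast+

lemma hull_path:
  assumes "0 < m" "m < r"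
  shows "arc_between (\<Union>i<m. E (v i) (v (Suc i))) (P (v 0)) (P (v m))"
  using assms
proof (induction m rule: nat_induct_non_zero)
  case 1
  then show ?case using E_arc[of "v 0" "v 1"] cp_vs2[of 0 1] by (simp add: lessThan_Suc)
next
  case (Suc m)
  have e: "E (v m) (v (Suc m)) \<inter> E (v i) (v (Suc i)) \<subseteq> {P (v m)}" if "i < m" for i
  proof (cases "Suc i = m")
    case True
    then show ?thesis using E_inter'(2)[of "v m" "v (Suc m)" "v i"] cp_vs3[of m "Suc m" i] Suc.prems by auto
  next
    case False
    then show ?thesis using cp_adjacent[of i "Suc i" m "Suc m"] that Suc.prems by auto
  qed
  have IH: "arc_between (\<Union>i<m. E (v i) (v (Suc i))) (P (v 0)) (P (v m))" using Suc by simp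
  have "P (v m) \<in> E (v m) (v (Suc m))" using E_ends(1) cp_vs2[of m "Suc m"] Suc.prems by simp
  then have int: "(\<Union>i<m. E (v i) (v (Suc i))) \<inter> E (v m) (v (Suc m)) = {P (v m)}"
    using arc_between_ends[OF IH] e by blast
  have "arc_between (E (v m) (v (Suc m))) (P (v m)) (P (v (Suc m)))"
    using E_arc cp_vs2[of m "Suc m"] Suc.prems by simp
  from arc_between_join[OF IH this int] show ?case by (simp add: lessThan_Suc Un_commute)
qed

lemma closed_curve_hull_cycle:
  assumes "3 \<le> r"
  shows "closed_curve (hull_cycle r v)"
proof -
  obtain m where m: "r = Suc m" "2 \<le> m" using assms by (cases r) auto
  let ?A = "\<Union>i<m. E (v i) (v (Suc i))"
  have A: "arc_between ?A (P (v 0)) (P (v m))" using hull_path m by simp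
  have B: "arc_between (E (v 0) (v m)) (P (v 0)) (P (v m))" using E_arc cp_vs2[of 0 m] m by simp
  have "E (v i) (v (Suc i)) \<inter> E (v 0) (v m) \<subseteq> {P (v 0), P (v m)}" if i: "i < m" for i
  proof -
    consider "i = 0" | "Suc i = m" | "0 < i" "Suc i < m" using i by linarith
    then show ?thesis
    proof cases
      case 1
      then show ?thesis using E_inter[of "v 0" "v 1" "v m"] cp_vs3[of 0 1 m] m by auto
    next
      case 2
      then show ?thesis using E_inter'(1)[of "v m" "v i" "v 0"] cp_vs3[of m i 0] m by auto
    next
      case 3
      then show ?thesis using cp_nested[of 0 i "Suc i" m] m by auto
    qed
  qed
  then have "?A \<inter> E (v 0) (v m) = {P (v 0), P (v m)}"
    using arc_between_ends[OF A] arc_between_ends[OF B] by blast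
  from closed_curveI[OF A B this] show ?thesis using hull_cycle_eq[of m v] m by simp
qed

lemma hull_cycle_S2: "2 \<le> r \<Longrightarrow> hull_cycle r v \<subseteq> S2"
proof -
  assume r: "2 \<le> r"
  have "E (v i) (v (Suc i mod r)) \<subseteq> S2" if "i < r" for i
  proof -
    have "Suc i mod r \<noteq> i" using that r by (metis One_nat_def Suc_le_lessD mod_Suc mod_less n_not_Suc_n numeral_2_eq_2 zero_neq_one less_irrefl_nat)
    moreover have "Suc i mod r < r" using r by simp
    ultimately show ?thesis using E_S2 cp_vs2[of i "Suc i mod r"] that by simp
  qed
  then show ?thesis unfolding hull_cycle_def by blast
qed

definition chord :: "nat \<Rightarrow> nat \<Rightarrow> bool" where
  "chord i j \<longleftrightarrow> i < j \<and> j < r \<and> Suc i < j \<and> \<not> (i = 0 \<and> Suc j = r)"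

text \<open>The ends of an edge of the cycle are cyclically adjacent, so it never alternates with a
  chord: it shares an end with it or falls under \<open>cp_adjacent\<close> or
  \<open>cp_nested\<close>.\<close>

lemma chord_Int_hull_cycle:
  assumes c: "chord i j"
  shows "E (v i) (v j) \<inter> hull_cycle r v \<subseteq> {P (v i), P (v j)}"
proof -
  obtain m where m: "r = Suc m" using c unfolding chord_def by (cases r) auto
  have ij: "i < j" "j \<le> m" "Suc i < j" "\<not> (i = 0 \<and> j = m)" using c m unfolding chord_def by auto
  have m0: "0 < m" using ij by linarith
  have "E (v i) (v j) \<inter> E (v k) (v (Suc k)) \<subseteq> {P (v i), P (v j)}" if k: "k < m" for k
  proof -
    consider "k = i" | "k = j" | "Suc k = i" | "Suc k = j" | "Suc k < i" | "i < k" "Suc k < j" | "j < k"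
      using ij by linarith
    then show ?thesis
    proof cases
      case 1
      then show ?thesis using E_inter[of "v i" "v j" "v (Suc k)"] cp_vs3[of i j "Suc k"] ij m k by auto
    next
      case 2
      then show ?thesis using E_inter'(3)[of "v j" "v i" "v (Suc k)"] cp_vs3[of j i "Suc k"] ij m k by auto
    next
      case 3
      then show ?thesis using E_inter'(2)[of "v i" "v j" "v k"] cp_vs3[of i j k] ij m k by auto
    next
      case 4
      then show ?thesis using E_inter'(1)[of "v j" "v i" "v k"] cp_vs3[of j i k] ij m k by auto
    next
      case 5
      then show ?thesis using cp_adjacent[of k "Suc k" i j] ij m by auto
    next
      case 6
      then show ?thesis using cp_nested[of i k "Suc k" j] ij m by auto
    next
      case 7
      then show ?thesis using cp_adjacent[of i j k "Suc k"] ij m k by auto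
    qed
  qed
  moreover have "E (v i) (v j) \<inter> E (v 0) (v m) \<subseteq> {P (v i), P (v j)}"
  proof -
    consider "i = 0" "j < m" | "j = m" "0 < i" | "0 < i" "j < m" using ij by linarith
    then show ?thesis
    proof cases
      case 1
      then show ?thesis using E_inter[of "v 0" "v j" "v m"] cp_vs3[of 0 j m] ij m by auto
    next
      case 2
      then show ?thesis using E_inter'(1)[of "v m" "v i" "v 0"] cp_vs3[of m i 0] ij m by auto
    next
      case 3
      then show ?thesis using cp_nested[of 0 i j m] ij m by auto
    qed
  qed
  ultimately show ?thesis unfolding m hull_cycle_eq[OF m0] by blast
qed

lemma chord_in_component:
  assumes c: "chord i j" and U: "U \<in> components (S2 - hull_cycle r v)" and m: "E (v i) (v j) \<inter> U \<noteq> {}"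
  shows "E (v i) (v j) \<subseteq> U \<union> hull_cycle r v"
proof -
  have ij: "vs [v i, v j]" "2 \<le> r" using cp_vs2[of i j] c unfolding chord_def by auto
  have "E (v i) (v j) - hull_cycle r v \<subseteq> U"
  proof (rule components_maximal[OF U])
    have "E (v i) (v j) - {P (v i), P (v j)} \<subseteq> E (v i) (v j) - hull_cycle r v"
      using chord_Int_hull_cycle[OF c] by blast
    then show "connected (E (v i) (v j) - hull_cycle r v)"
      using arc_between_connected_sub[OF E_arc[of "v i" "v j"]] ij by auto
    show "E (v i) (v j) - hull_cycle r v \<subseteq> S2 - hull_cycle r v" using E_S2[of "v i" "v j"] ij by auto
    show "U \<inter> (E (v i) (v j) - hull_cycle r v) \<noteq> {}" using m in_components_subset[OF U] by blast
  qed
  then show ?thesis by blast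
qed

text \<open>The common point of two alternating chords is none of their ends, hence lies off the
  cycle, and off the cycle each chord stays within one component.\<close>

lemma crossing_chords_same_component:
  assumes o: "i < j" "j < k" "k < l" "l < r" and U: "U \<in> components (S2 - hull_cycle r v)"
  shows "E (v i) (v k) \<inter> U \<noteq> {} \<longleftrightarrow> E (v j) (v l) \<inter> U \<noteq> {}"
proof -
  have c: "chord i k" "chord j l" using o unfolding chord_def by auto
  obtain p where p: "p \<in> E (v i) (v k)" "p \<in> E (v j) (v l)" using cp_cross[OF o] by blast
  have "p \<noteq> P (v i)" "p \<noteq> P (v k)"
    using p(2) P_notin_E[of "v j" "v l" "v i"] P_notin_E[of "v j" "v l" "v k"] cp_vs3[of j l i] cp_vs3[of j l k] o by auto
  then have "p \<notin> hull_cycle r v" using chord_Int_hull_cycle[OF c(1)] p(1) by blast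
  then show ?thesis
    using chord_in_component[OF c(1) U] chord_in_component[OF c(2) U] p by blast
qed

text \<open>Crossings link every chord to \<open>02\<close>, so all chords run in the component
  \<open>U\<close> that \<open>02\<close> enters, and the opposite component \<open>F\<close> meets
  no edge.\<close>

lemma hull_cycle_bounds_face:
  assumes r: "5 \<le> r"
  obtains F where "F \<in> components (S2 - (\<Union>i<r. \<Union>j\<in>{..<r} - {i}. E (v i) (v j)))"
    "(top_of_set S2) frontier_of F = hull_cycle r v"
proof -
  let ?C = "hull_cycle r v"
  have cc: "closed_curve ?C" "?C \<subseteq> S2" using closed_curve_hull_cycle hull_cycle_S2 r by auto
  have c02: "chord 0 2" "0 < r" "2 < r" unfolding chord_def using r by auto
  have "E (v 0) (v 2) - {P (v 0), P (v 2)} \<noteq> {}"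
    using arc_between_interior(2)[OF E_arc[of "v 0" "v 2"]] cp_vs2[of 0 2] c02 by auto
  then obtain z where z: "z \<in> E (v 0) (v 2)" "z \<notin> ?C"
    using chord_Int_hull_cycle[OF c02(1)] by blast
  have zS: "z \<in> S2 - ?C" using z E_S2[of "v 0" "v 2"] cp_vs2[of 0 2] c02 by auto
  define U where "U = connected_component_set (S2 - ?C) z"
  have U: "U \<in> components (S2 - ?C)" "z \<in> U"
    unfolding U_def using zS by (auto simp: components_def)
  have base: "E (v 0) (v 2) \<inter> U \<noteq> {}" using z U by blast
  have one: "E (v 1) (v l) \<inter> U \<noteq> {}" if "3 \<le> l" "l < r" for l
    using crossing_chords_same_component[of 0 1 2 l U] U base that by auto
  \<comment> \<open>For \<open>i = 0\<close> the chord crosses the one from \<open>1\<close> to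
    \<open>Suc j\<close>, and for \<open>i\<close> at least 2 the one from \<open>1\<close> to
    \<open>Suc i\<close>; both of these cross \<open>02\<close>.\<close>
  have all: "E (v i) (v j) \<inter> U \<noteq> {}" if c: "chord i j" for i j
  proof -
    consider "i = 0" | "i = 1" | "2 \<le> i" by linarith
    then show ?thesis
    proof cases
      case 1
      then have "2 \<le> j" "Suc j < r" using c unfolding chord_def by auto
      then show ?thesis
        using 1 crossing_chords_same_component[of 0 1 j "Suc j" U] U one[of "Suc j"] by auto
    next
      case 2
      then show ?thesis using one[of j] c unfolding chord_def by auto
    next
      case 3
      then show ?thesis
        using crossing_chords_same_component[of 1 i "Suc i" j U] U one[of "Suc i"] c unfolding chord_def by auto
    qed
  qed
  have lt: "E (v i) (v j) \<subseteq> U \<union> ?C" if ij: "i < j" "j < r" for i j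
  proof -
    consider "chord i j" | "j = Suc i" | "i = 0" "Suc j = r" using ij unfolding chord_def by linarith
    then show ?thesis
    proof cases
      case 1
      show ?thesis using chord_in_component[OF 1 U(1) all[OF 1]] .
    next
      case 2
      then show ?thesis using hull_cycle_edge[of i r v] ij by auto
    next
      case 3
      then show ?thesis using hull_cycle_edge[of j r v] E_commute[of "v j" "v i"] ij by auto
    qed
  qed
  define D where "D = (\<Union>i<r. \<Union>j\<in>{..<r} - {i}. E (v i) (v j))"
  have DU: "D \<subseteq> U \<union> ?C"
    unfolding D_def
  proof (intro UN_least)
    fix i j assume "i \<in> {..<r}" "j \<in> {..<r} - {i}"
    then show "E (v i) (v j) \<subseteq> U \<union> ?C"
      using lt[of i j] lt[of j i] E_commute[of "v i" "v j"] by (cases "i < j") auto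
  qed
  have CD: "?C \<subseteq> D"
  proof -
    have "Suc i mod r \<in> {..<r} - {i}" if "i < r" for i
      using that r by (cases "Suc i = r") auto
    then show ?thesis unfolding hull_cycle_def D_def by blast
  qed
  obtain F where F: "jordan_sides ?C U F" "F \<in> components (S2 - ?C)"
    using component_other_side[OF cc U(1)] by metis
  have fd: "U \<inter> F = {}" "F \<inter> ?C = {}" "F \<subseteq> S2" "closure F = F \<union> ?C" "openin (top_of_set S2) F"
    using F(1) unfolding jordan_sides_def by auto
  have "F \<inter> D = {}" using DU fd(1,2) by blast
  then have "F \<subseteq> S2 - D" using fd(3) by blast
  moreover have "F \<noteq> {}" "connected F"
    using in_components_nonempty[OF F(2)] in_components_connected[OF F(2)] .
  moreover have "F' = F" if "F \<subseteq> F'" "F' \<subseteq> S2 - D" "connected F'" for F'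
  proof -
    have "F' \<subseteq> S2 - ?C" using that(2) CD by blast
    then have "F' \<subseteq> F" using components_maximal[OF F(2) that(3)] that(1) \<open>F \<noteq> {}\<close> by blast
    then show ?thesis using that(1) by blast
  qed
  ultimately have "F \<in> components (S2 - D)"
    unfolding in_components_maximal by blast
  moreover have "(top_of_set S2) frontier_of F = ?C"
  proof -
    have "(top_of_set S2) closure_of F = S2 \<inter> closure F" using fd(3) by (simp add: closure_of_subtopology Int_absorb1)
    moreover have "(top_of_set S2) interior_of F = F" using fd(5) by (simp add: interior_of_openin)
    ultimately show ?thesis unfolding frontier_of_def using fd cc(2) by auto
  qed
  ultimately show ?thesis using that unfolding D_def by blast
qed

end

end

section \<open>Ramsey arguments and natural drawings\<close>

text \<open>\<open>qs ! x\<close> is the size demanded of a set homogeneous in colour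
  \<open>x\<close>. The colour may depend on the order of its arguments, as crossing patterns do, so
  the homogeneous set comes as an enumeration \<open>h\<close>.\<close>

definition quad_ramsey :: "nat \<Rightarrow> nat list \<Rightarrow> bool" where
  "quad_ramsey N qs \<longleftrightarrow> (\<forall>col :: nat \<Rightarrow> nat \<Rightarrow> nat \<Rightarrow> nat \<Rightarrow> nat. (\<forall>a b c d. col a b c d < length qs) \<longrightarrow>
    (\<exists>x<length qs. \<exists>h. inj_on h {..<qs ! x} \<and> h ` {..<qs ! x} \<subseteq> {..<N} \<and>
      (\<forall>i j k l. i < j \<longrightarrow> j < k \<longrightarrow> k < l \<longrightarrow> l < qs ! x \<longrightarrow> col (h i) (h j) (h k) (h l) = x)))"

lemma quad_ramsey_exists: "\<exists>N. quad_ramsey N qs"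
proof -
  obtain N :: nat where N: "partn_lst {..<N} qs 4" using ramsey_full by blast
  have "\<exists>x<length qs. \<exists>h. inj_on h {..<qs ! x} \<and> h ` {..<qs ! x} \<subseteq> {..<N} \<and>
      (\<forall>i j k l. i < j \<longrightarrow> j < k \<longrightarrow> k < l \<longrightarrow> l < qs ! x \<longrightarrow> col (h i) (h j) (h k) (h l) = x)"
    if col: "\<forall>a b c d. col a b c d < length qs" for col :: "nat \<Rightarrow> nat \<Rightarrow> nat \<Rightarrow> nat \<Rightarrow> nat"
  proof -
    define f where "f S = (let xs = sorted_list_of_set S in col (xs ! 0) (xs ! 1) (xs ! 2) (xs ! 3))" for S
    have "f \<in> nsets {..<N} 4 \<rightarrow> {..<length qs}" using col by (auto simp: f_def Let_def)
    then obtain x H where x: "x < length qs" and H: "H \<in> nsets {..<N} (qs ! x)" "f ` nsets H 4 \<subseteq> {x}"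
      using partn_lstE[OF N] by blast
    have fH: "finite H" "card H = qs ! x" "H \<subseteq> {..<N}" using H(1) by (auto simp: nsets_def)
    define h where "h i = sorted_list_of_set H ! i" for i
    have len: "length (sorted_list_of_set H) = qs ! x" using fH by simp
    have less: "h i < h j" if "i < j" "j < qs ! x" for i j
      unfolding h_def using sorted_wrt_nth_less[OF strict_sorted_list_of_set[of H]] that len by auto
    have mem: "h i \<in> H" if "i < qs ! x" for i
      unfolding h_def using nth_mem[of i "sorted_list_of_set H"] that len fH(1) by simp
    have "inj_on h {..<qs ! x}"
      by (intro linorder_inj_onI) (use less in \<open>auto simp: less_imp_neq\<close>)
    moreover have "h ` {..<qs ! x} \<subseteq> {..<N}" using mem fH(3) by blast
    moreover have "col (h i) (h j) (h k) (h l) = x" if o: "i < j" "j < k" "k < l" "l < qs ! x" for i j k l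
    proof -
      have lt: "h i < h j" "h j < h k" "h k < h l" using less o by auto
      have "{h i, h j, h k, h l} \<in> nsets H 4"
        using lt mem o by (auto simp: nsets_def)
      then have "f {h i, h j, h k, h l} = x" using H(2) by blast
      moreover have "sorted_list_of_set (set [h i, h j, h k, h l]) = [h i, h j, h k, h l]"
        by (rule sorted_list_of_set.idem_if_sorted_distinct) (use lt in auto)
      ultimately show ?thesis by (simp add: f_def numeral_3_eq_3 numeral_2_eq_2)
    qed
    ultimately show ?thesis using x by blast
  qed
  then show ?thesis unfolding quad_ramsey_def by blast
qed

lemma (in convex_complete_drawing) convex_position_exists:
  assumes N: "quad_ramsey N [5, 5, 5, 2 * r]" and g: "inj_on g {..<N}" "g ` {..<N} \<subseteq> V"
  obtains v where "convex_position r v"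
proof -
  \<comment> \<open>Colour 0 is planar, 1 the adjacent and 2 the nested pattern; 3 is the rest,
    which \<open>cross_exists\<close> identifies as the alternating pattern.\<close>
  define col :: "nat \<Rightarrow> nat \<Rightarrow> nat \<Rightarrow> nat \<Rightarrow> nat" where
    "col a b c d = (if planar4 (g a) (g b) (g c) (g d) then 0 else if cross (g a) (g b) (g c) (g d) then 1
      else if cross (g a) (g d) (g b) (g c) then 2 else 3)" for a b c d
  define qs where "qs = [5, 5, 5, 2 * r]"
  have "\<forall>a b c d. col a b c d < length qs" unfolding col_def qs_def by simp
  then obtain x h where x: "x < length qs" and h: "inj_on h {..<qs ! x}" "h ` {..<qs ! x} \<subseteq> {..<N}"
    and hom: "\<And>i j k l. i < j \<Longrightarrow> j < k \<Longrightarrow> k < l \<Longrightarrow> l < qs ! x \<Longrightarrow> col (h i) (h j) (h k) (h l) = x"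
    using N unfolding quad_ramsey_def qs_def[symmetric] by metis
  define w where "w = g \<circ> h"
  have w: "inj_on w {..<qs ! x}" "w ` {..<qs ! x} \<subseteq> V"
    unfolding w_def using h g by (auto intro: comp_inj_on inj_on_subset)
  have d: "vs (map w xs)" if "distinct xs" "\<forall>y\<in>set xs. y < qs ! x" for xs
  proof -
    have "inj_on w (set xs)" by (rule inj_on_subset[OF w(1)]) (use that in auto)
    then show ?thesis using that w(2) by (auto simp: distinct_map)
  qed
  have colour: "(x = 0 \<longrightarrow> p) \<and> (x = 1 \<longrightarrow> \<not> p \<and> q) \<and> (x = 2 \<longrightarrow> \<not> p \<and> s) \<and> (x = 3 \<longrightarrow> \<not> p \<and> \<not> q \<and> \<not> s)"
    if "(if p then 0 else if q then 1 else if s then 2 else 3) = x" for p q s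
    using that by (cases p; cases q; cases s) auto
  have W: "(x = 0 \<longrightarrow> planar4 (w i) (w j) (w k) (w l)) \<and>
      (x = 1 \<longrightarrow> \<not> planar4 (w i) (w j) (w k) (w l) \<and> cross (w i) (w j) (w k) (w l)) \<and>
      (x = 2 \<longrightarrow> \<not> planar4 (w i) (w j) (w k) (w l) \<and> cross (w i) (w l) (w j) (w k)) \<and>
      (x = 3 \<longrightarrow> \<not> planar4 (w i) (w j) (w k) (w l) \<and> \<not> cross (w i) (w j) (w k) (w l) \<and>
        \<not> cross (w i) (w l) (w j) (w k))"
    if "i < j" "j < k" "k < l" "l < qs ! x" for i j k l
    using colour[OF hom[OF that, unfolded col_def]] unfolding w_def comp_def .
  consider "x = 0" | "x = 1" | "x = 2" | "x = 3" using x unfolding qs_def by fastforce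
  then show ?thesis
  proof cases
    case 1
    then have q: "qs ! x = 5" unfolding qs_def by simp
    have "planar4 (w i) (w j) (w k) (w l)" if "i < j" "j < k" "k < l" "l < 5" for i j k l
      using W[OF that(1-3)] that(4) unfolding q by (simp add: 1)
    from this[of 0 1 2 3] this[of 0 1 2 4] this[of 0 1 3 4] this[of 0 2 3 4] this[of 1 2 3 4]
    show ?thesis using K5_not_planar[of "w 0" "w 1" "w 2" "w 3" "w 4"] d[of "[0, 1, 2, 3, 4]"] q by simp
  next
    case 2
    then have q: "qs ! x = 5" unfolding qs_def by simp
    have "\<not> planar4 (w i) (w j) (w k) (w l) \<and> cross (w i) (w j) (w k) (w l)" if "i < j" "j < k" "k < l" "l < 5" for i j k l
      using W[OF that(1-3)] that(4) unfolding q by (simp add: 2)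
    from this[of 0 1 2 3] this[of 0 1 2 4] this[of 0 1 3 4] this[of 0 2 3 4] this[of 1 2 3 4]
    show ?thesis
      using cross_pattern_adjacent_impossible[of "w 0" "w 1" "w 2" "w 3" "w 4"] d[of "[0, 1, 2, 3, 4]"] q by simp
  next
    case 3
    then have q: "qs ! x = 5" unfolding qs_def by simp
    have "\<not> planar4 (w i) (w j) (w k) (w l) \<and> cross (w i) (w l) (w j) (w k)" if "i < j" "j < k" "k < l" "l < 5" for i j k l
      using W[OF that(1-3)] that(4) unfolding q by (simp add: 3)
    from this[of 0 1 2 3] this[of 0 1 2 4] this[of 0 1 3 4] this[of 0 2 3 4] this[of 1 2 3 4]
    show ?thesis
      using cross_pattern_nested_impossible[of "w 0" "w 1" "w 2" "w 3" "w 4"] d[of "[0, 1, 2, 3, 4]"] q by simp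
  next
    case 4
    then have q: "qs ! x = 2 * r" unfolding qs_def by simp
    have "\<not> planar4 (w i) (w j) (w k) (w l) \<and> cross (w i) (w k) (w j) (w l)"
      if "i < j" "j < k" "k < l" "l < 2 * r" for i j k l
    proof -
      have "\<not> planar4 (w i) (w j) (w k) (w l)" "\<not> cross (w i) (w j) (w k) (w l)" "\<not> cross (w i) (w l) (w j) (w k)"
        using W[OF that(1-3)] that(4) unfolding q by (simp_all add: 4)
      moreover have "vs [w i, w j, w k, w l]" using d[of "[i, j, k, l]"] that q by auto
      ultimately show ?thesis using cross_exists by blast
    qed
    then show ?thesis using that convex_position_of_alternating[of w r] w q by simp
  qed
qed

section \<open>From drawings of complete graphs to the locale\<close>

text \<open>Both sides of \<open>C\<close> are connected and miss the frontier of \<open>D\<close>,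
  so each lies in \<open>D\<close> or outside it. Both inside would make \<open>D\<close> the whole
  sphere, with empty frontier; both outside would leave \<open>D = C\<close>, but a circle is not
  contractible and a disc is.\<close>

lemma side_closure_component:
  assumes C: "closed_curve C" "C \<subseteq> S2" and D: "D \<subseteq> S2" "D homeomorphic cball (0::real^2) 1"
    and fr: "(top_of_set S2) frontier_of D = C"
  obtains U where "U \<in> components (S2 - C)" "D = closure U"
proof -
  have "compact D" using D(2) homeomorphic_compactness compact_cball by blast
  then have clD: "closed D" by (rule compact_imp_closed)
  have "(top_of_set S2) closure_of D = D"
    using clD D(1) by (simp add: closure_of_closedin closed_subset)
  then have CD: "C \<subseteq> D" using fr by (auto simp: frontier_of_def)
  obtain U V where J: "jordan_sides C U V" "components (S2 - C) = {U, V}"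
    using jordan_sides_exist[OF C] by metis
  have side: "W \<subseteq> D \<or> W \<inter> D = {}" if "W \<in> {U, V}" for W
  proof -
    have W: "connected W" "W \<subseteq> S2" "W \<inter> C = {}" using that J(1) unfolding jordan_sides_def by auto
    then have "connectedin (top_of_set S2) W" by (simp add: connectedin_subtopology)
    then show ?thesis using connectedin_Int_frontier_of[of "top_of_set S2" W D] W(3) fr by blast
  qed
  have UV: "U \<union> V = S2 - C" "U \<inter> V = {}" "U \<noteq> {}" "V \<noteq> {}" "closure U = U \<union> C" "closure V = V \<union> C"
    using J(1) unfolding jordan_sides_def by auto
  have inn: "\<not> (U \<subseteq> D \<and> V \<subseteq> D)"
  proof
    assume "U \<subseteq> D \<and> V \<subseteq> D"
    then have "D = S2" using D(1) CD UV(1) by blast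
    then have "(top_of_set S2) frontier_of D = {}"
      using frontier_of_topspace[of "top_of_set S2"] by simp
    then show False using fr closed_curve_nonempty[OF C(1)] by simp
  qed
  have out: "\<not> (U \<inter> D = {} \<and> V \<inter> D = {})"
  proof
    assume "U \<inter> D = {} \<and> V \<inter> D = {}"
    then have "D = C" using D(1) CD UV(1) by blast
    then have "sphere (0::complex) 1 homeomorphic cball (0::real^2) 1"
      using closed_curve_homeomorphic_circle[OF C(1)] D(2) homeomorphic_sym homeomorphic_trans by blast
    then have "contractible (sphere (0::complex) 1)"
      using homeomorphic_contractible_eq convex_imp_contractible[OF convex_cball] by blast
    then show False by (simp add: contractible_sphere)
  qed
  have "D = closure U \<or> D = closure V"
  proof -
    have "D \<subseteq> U \<union> V \<union> C" using D(1) UV(1) by blast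
    moreover have "U \<subseteq> D \<or> U \<inter> D = {}" "V \<subseteq> D \<or> V \<inter> D = {}" using side by simp_all
    ultimately have "D = U \<union> C \<or> D = V \<union> C"
      using CD inn out by blast
    then show ?thesis using UV(5,6) by simp
  qed
  then show ?thesis using that J(2) by blast
qed

lemma is_drawingD:
  assumes "is_drawing G D"
  shows "simple_graph G" "vpoint D ` verts G \<subseteq> S2" "inj_on (vpoint D) (verts G)"
    "\<forall>u v. {u, v} \<in> edges G \<longrightarrow> (\<exists>g. arc g \<and> path_image g = ecurve D {u, v} \<and> path_image g \<subseteq> S2 \<and>
       {pathstart g, pathfinish g} = {vpoint D u, vpoint D v})"
    "\<lbrakk>e \<in> edges G; w \<in> verts G; vpoint D w \<in> ecurve D e\<rbrakk> \<Longrightarrow> w \<in> e"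
    "\<lbrakk>e \<in> edges G; f \<in> edges G; e \<noteq> f\<rbrakk> \<Longrightarrow> finite (ecurve D e \<inter> ecurve D f)"
    "\<lbrakk>e \<in> edges G; f \<in> edges G; e \<noteq> f; e \<inter> f \<noteq> {}\<rbrakk> \<Longrightarrow> ecurve D e \<inter> ecurve D f \<subseteq> vpoint D ` (e \<inter> f)"
    "\<lbrakk>e \<in> edges G; f \<in> edges G; e \<noteq> f\<rbrakk> \<Longrightarrow> card (ecurve D e \<inter> ecurve D f) \<le> 1"
  using assms unfolding is_drawing_def by - (elim conjE, (assumption | simp))+

lemma subgraph_drawing:
  assumes D: "is_drawing G D" and H: "subgraph H G"
  shows "is_drawing H (induced_drawing D H)"
proof -
  have sub: "verts H \<subseteq> verts G" "edges H \<subseteq> edges G" "simple_graph H" using H unfolding subgraph_def by auto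
  have e: "e \<subseteq> verts H" if "e \<in> edges H" for e using sub(3) that unfolding simple_graph_def by auto
  have im: "restrict (vpoint D) (verts H) ` X = vpoint D ` X" if "X \<subseteq> verts H" for X
    using that by (auto intro!: image_cong)
  have arcs: "\<exists>g. arc g \<and> path_image g = restrict (ecurve D) (edges H) {u, v} \<and> path_image g \<subseteq> S2 \<and>
      {pathstart g, pathfinish g} = {restrict (vpoint D) (verts H) u, restrict (vpoint D) (verts H) v}"
    if "{u, v} \<in> edges H" for u v
  proof -
    have "u \<in> verts H" "v \<in> verts H" using e[OF that] by auto
    then show ?thesis using is_drawingD(4)[OF D] that sub(2) by auto
  qed
  show ?thesis
    unfolding is_drawing_def induced_drawing_def drawing.simps
  proof (intro conjI allI impI ballI)
    show "simple_graph H" by (rule sub)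
    show "restrict (vpoint D) (verts H) ` verts H \<subseteq> S2"
      using is_drawingD(2)[OF D] sub(1) im[of "verts H"] by auto
    show "inj_on (restrict (vpoint D) (verts H)) (verts H)"
      using inj_on_subset[OF is_drawingD(3)[OF D] sub(1)] by (auto simp: inj_on_def)
  next
    fix u v assume "{u, v} \<in> edges H"
    then show "\<exists>g. arc g \<and> path_image g = restrict (ecurve D) (edges H) {u, v} \<and> path_image g \<subseteq> S2 \<and>
      {pathstart g, pathfinish g} = {restrict (vpoint D) (verts H) u, restrict (vpoint D) (verts H) v}"
      by (rule arcs)
  next
    fix f w assume "f \<in> edges H" "w \<in> verts H" "restrict (vpoint D) (verts H) w \<in> restrict (ecurve D) (edges H) f"
    then show "w \<in> f" using is_drawingD(5)[OF D, of f w] sub by auto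
  next
    fix f f' assume f: "f \<in> edges H" "f' \<in> edges H" "f \<noteq> f'"
    have "finite (ecurve D f \<inter> ecurve D f') \<and>
        (f \<inter> f' \<noteq> {} \<longrightarrow> ecurve D f \<inter> ecurve D f' \<subseteq> vpoint D ` (f \<inter> f')) \<and>
        card (ecurve D f \<inter> ecurve D f') \<le> 1"
      using is_drawingD(6-8)[OF D, of f f'] f sub(2) by auto
    moreover have "restrict (vpoint D) (verts H) ` (f \<inter> f') = vpoint D ` (f \<inter> f')"
      using e[OF f(1)] by (intro im) auto
    ultimately show "finite (restrict (ecurve D) (edges H) f \<inter> restrict (ecurve D) (edges H) f')"
      "f \<inter> f' \<noteq> {} \<Longrightarrow> restrict (ecurve D) (edges H) f \<inter> restrict (ecurve D) (edges H) f' \<subseteq>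
        restrict (vpoint D) (verts H) ` (f \<inter> f')"
      "card (restrict (ecurve D) (edges H) f \<inter> restrict (ecurve D) (edges H) f') \<le> 1"
      using f by simp_all
  qed
qed

lemma drawn_induced:
  assumes "verts K \<subseteq> verts H" "edges K \<subseteq> edges H"
  shows "drawn (induced_drawing D H) K = drawn D K"
proof -
  have "restrict (vpoint D) (verts H) ` verts K = vpoint D ` verts K"
    by (intro image_cong) (use assms in auto)
  moreover have "(\<Union>e\<in>edges K. restrict (ecurve D) (edges H) e) = (\<Union>e\<in>edges K. ecurve D e)"
    by (intro SUP_cong) (use assms in auto)
  ultimately show ?thesis unfolding drawn_def induced_drawing_def by simp
qed

lemma complete_graph_edge: "{u, v} \<in> edges (complete_graph n) \<longleftrightarrow> u < n \<and> v < n \<and> u \<noteq> v"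
  unfolding complete_graph_def by (auto simp: doubleton_eq_iff)

lemma convex_drawing_locale:
  assumes "convex_drawing (complete_graph n) D"
  shows "convex_complete_drawing {..<n} (vpoint D) (\<lambda>u v. ecurve D {u, v})"
proof -
  let ?G = "complete_graph n" and ?E = "\<lambda>u v. ecurve D {u, v}"
  have D: "is_drawing ?G D" using assms unfolding convex_drawing_def by simp
  have V: "verts ?G = {..<n}" unfolding complete_graph_def by simp
  note ed = complete_graph_edge[of _ _ n]
  have arc: "arc_between (?E u v) (vpoint D u) (vpoint D v)" "?E u v \<subseteq> S2"
    if uv: "u < n" "v < n" "u \<noteq> v" for u v
  proof -
    have "{u, v} \<in> edges ?G" using uv ed by simp
    then obtain g where g: "arc g" "path_image g = ?E u v" "path_image g \<subseteq> S2"
      "{pathstart g, pathfinish g} = {vpoint D u, vpoint D v}"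
      using is_drawingD(4)[OF D] by metis
    then show "?E u v \<subseteq> S2" by simp
    have "arc_between (?E u v) (pathstart g) (pathfinish g)" unfolding arc_between_def using g by blast
    moreover have "pathstart g = vpoint D u \<and> pathfinish g = vpoint D v \<or>
      pathstart g = vpoint D v \<and> pathfinish g = vpoint D u"
      using g(4) by (auto simp: doubleton_eq_iff)
    ultimately show "arc_between (?E u v) (vpoint D u) (vpoint D v)" using arc_between_sym by metis
  qed
  have two: "finite (ecurve D e \<inter> ecurve D f)" "e \<inter> f \<noteq> {} \<Longrightarrow> ecurve D e \<inter> ecurve D f \<subseteq> vpoint D ` (e \<inter> f)"
    "card (ecurve D e \<inter> ecurve D f) \<le> 1" if "e \<in> edges ?G" "f \<in> edges ?G" "e \<noteq> f" for e f
    using is_drawingD(6-8)[OF D that] by blast+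
  have inj: "inj_on (vpoint D) {..<n}" using is_drawingD(3)[OF D] V by simp
  have vx: "w = u \<or> w = v" if "u < n" "v < n" "w < n" "u \<noteq> v" "vpoint D w \<in> ?E u v" for u v w
  proof -
    have "w \<in> {u, v}" using is_drawingD(5)[OF D, of "{u, v}" w] that ed V by auto
    then show ?thesis by simp
  qed
  have adj: "?E u v \<inter> ?E u w \<subseteq> {vpoint D u}" if "u < n" "v < n" "w < n" "distinct [u, v, w]" for u v w
  proof -
    have "{u, v} \<noteq> {u, w}" "{u, v} \<inter> {u, w} = {u}" using that by (auto simp: doubleton_eq_iff)
    then show ?thesis using two(2)[of "{u, v}" "{u, w}"] ed that by simp
  qed
  have once: "p = q" if "u < n" "v < n" "x < n" "y < n" "distinct [u, v, x, y]"
    "p \<in> ?E u v \<inter> ?E x y" "q \<in> ?E u v \<inter> ?E x y" for u v x y p q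
  proof -
    have "{u, v} \<noteq> {x, y}" using that by (auto simp: doubleton_eq_iff)
    \<comment> \<open>Finiteness matters: an infinite set has \<open>card\<close> 0, so the bound on
      \<open>card\<close> alone would permit infinitely many common points.\<close>
    then have "finite (?E u v \<inter> ?E x y)" "card (?E u v \<inter> ?E x y) \<le> Suc 0"
      using two(1,3)[of "{u, v}" "{x, y}"] ed that by auto
    then show ?thesis using card_le_Suc0_iff_eq that(6,7) by blast
  qed
  have cv: "\<exists>U \<in> components (S2 - (?E a b \<union> ?E b c \<union> ?E a c)). \<forall>x\<in>{..<n}. \<forall>y\<in>{..<n}. x \<noteq> y \<longrightarrow>
        vpoint D x \<in> closure U \<longrightarrow> vpoint D y \<in> closure U \<longrightarrow> ?E x y \<subseteq> closure U"
    if abc: "a < n" "b < n" "c < n" "distinct [a, b, c]" for a b c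
  proof -
    define T where "T = \<lparr>verts = {a, b, c}, edges = {{a, b}, {b, c}, {a, c}}\<rparr>"
    have "subgraph T ?G"
      unfolding subgraph_def simple_graph_def T_def using abc ed V by auto
    moreover have "is_cycle 3 T"
      unfolding is_cycle_def
    proof (intro conjI exI[of _ "[a, b, c]"])
      have three: "{f i |i. i < (3::nat)} = {f 0, f 1, f 2}" for f :: "nat \<Rightarrow> nat set"
        by (auto simp: numeral_3_eq_3 numeral_2_eq_2 less_Suc_eq)
      have "{{[a, b, c] ! i, [a, b, c] ! (Suc i mod 3)} |i. i < 3} = {{a, b}, {b, c}, {c, a}}"
        unfolding three by (simp add: numeral_2_eq_2)
      then show "edges T = {{[a, b, c] ! i, [a, b, c] ! (Suc i mod 3)} |i. i < 3}"
        unfolding T_def by (simp add: insert_commute[of c a])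
    qed (use abc in \<open>auto simp: T_def\<close>)
    ultimately obtain \<Delta> where \<Delta>: "convex_side ?G D T \<Delta>"
      using assms unfolding convex_drawing_def by blast
    define C where "C = ?E a b \<union> ?E b c \<union> ?E a c"
    have arcs: "arc_between (?E a b) (vpoint D a) (vpoint D b)" "arc_between (?E b c) (vpoint D b) (vpoint D c)"
      "arc_between (?E a c) (vpoint D a) (vpoint D c)" using arc abc by auto
    have i: "?E a b \<inter> ?E b c = {vpoint D b}" "?E a b \<inter> ?E a c = {vpoint D a}" "?E b c \<inter> ?E a c = {vpoint D c}"
      using adj[of b a c] adj[of a b c] adj[of c b a] arcs[THEN arc_between_ends] abc
      by (auto simp: insert_commute)
    have dC: "drawn D T = C"
      unfolding drawn_def T_def C_def using arcs[THEN arc_between_ends] by auto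
    have "(?E a b \<union> ?E b c) \<inter> ?E a c = {vpoint D a, vpoint D c}" using i by auto
    then have cc: "closed_curve C"
      unfolding C_def using closed_curveI[OF arc_between_join[OF arcs(1,2) i(1)] arcs(3)] by simp
    have CS: "C \<subseteq> S2" unfolding C_def using arc(2) abc by auto
    obtain U where U: "U \<in> components (S2 - C)" "\<Delta> = closure U"
      using side_closure_component[OF cc CS, of \<Delta>] \<Delta> dC unfolding convex_side_def is_side_def by metis
    then show ?thesis using \<Delta> V unfolding convex_side_def C_def by blast
  qed
  show ?thesis
    by unfold_locales (use inj arc vx adj once cv in \<open>auto simp: insert_commute\<close>)
qed

theorem theorem3p2:
  fixes r :: nat
  assumes "r \<ge> 5"
  shows "\<exists>N::nat. \<forall>n\<ge>N. \<forall>D. convex_drawing (complete_graph n) D \<longrightarrow>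
    (\<exists>J. subgraph J (complete_graph n) \<and> graph_iso J (complete_graph r) \<and>
         natural_drawing J (induced_drawing D J))"
proof -
  obtain N where N: "quad_ramsey N [5, 5, 5, 2 * r]" using quad_ramsey_exists by blast
  have "\<exists>J. subgraph J (complete_graph n) \<and> graph_iso J (complete_graph r) \<and>
         natural_drawing J (induced_drawing D J)"
    if n: "n \<ge> N" and D: "convex_drawing (complete_graph n) D" for n D
  proof -
    interpret convex_complete_drawing "{..<n}" "vpoint D" "\<lambda>u v. ecurve D {u, v}"
      by (rule convex_drawing_locale[OF D])
    \<comment> \<open>The first \<open>N\<close> vertices suffice, hence the embedding
      \<open>id\<close>.\<close>
    obtain v where v: "convex_position r v"
      using convex_position_exists[OF N, of id] n by auto
    then have inj: "inj_on v {..<r}" and vV: "v ` {..<r} \<subseteq> {..<n}" unfolding convex_position_def by auto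
    define J where "J = \<lparr>verts = v ` {..<r}, edges = {{v i, v j} |i j. i < r \<and> j < r \<and> i \<noteq> j}\<rparr>"
    define K where "K = \<lparr>verts = v ` {..<r}, edges = {{v i, v (Suc i mod r)} |i. i < r}\<rparr>"
    have suc: "Suc i mod r < r \<and> Suc i mod r \<noteq> i" if "i < r" for i
      using that assms by (cases "Suc i = r") auto
    have vn: "v i < n" if "i < r" for i using vV that by blast
    have vij: "v i \<noteq> v j" if "i < r" "j < r" "i \<noteq> j" for i j
      using inj_on_eq_iff[OF inj, of i j] that by simp
    have JV: "verts J = v ` {..<r}" and KV: "verts K = v ` {..<r}" unfolding J_def K_def by simp_all
    have JE: "e \<in> edges J \<longleftrightarrow> (\<exists>i j. e = {v i, v j} \<and> i < r \<and> j < r \<and> i \<noteq> j)" for e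
      unfolding J_def by auto
    have KE: "e \<in> edges K \<longleftrightarrow> (\<exists>i. e = {v i, v (Suc i mod r)} \<and> i < r)" for e
      unfolding K_def by auto
    have eJ: "e \<in> edges (complete_graph n) \<and> e \<subseteq> verts J \<and> card e = 2" if e: "e \<in> edges J" for e
    proof -
      obtain i j where ij: "e = {v i, v j}" "i < r" "j < r" "i \<noteq> j" using e JE by blast
      then show ?thesis using vij[of i j] vn[of i] vn[of j] JV by (simp add: complete_graph_edge)
    qed
    have "finite (verts J)" using JV by simp
    moreover have "verts J \<subseteq> verts (complete_graph n)" using vn JV by (auto simp: complete_graph_def)
    moreover have "edges J \<subseteq> edges (complete_graph n)" "\<forall>e\<in>edges J. e \<subseteq> verts J \<and> card e = 2"
      using eJ by (simp_all add: subset_iff)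
    ultimately have sJ: "subgraph J (complete_graph n)"
      unfolding subgraph_def simple_graph_def by simp
    have KEJ: "e \<in> edges J \<and> e \<subseteq> verts K" if e: "e \<in> edges K" for e
    proof -
      obtain i where i: "e = {v i, v (Suc i mod r)}" "i < r" using e KE by blast
      then have "e \<in> edges J" unfolding JE using suc[OF i(2)] by metis
      then show ?thesis using i suc[OF i(2)] KV by auto
    qed
    have KJ: "verts K \<subseteq> verts J" "edges K \<subseteq> edges J"
      unfolding JV KV using KEJ by (simp_all add: subset_iff)
    have "\<forall>e\<in>edges K. e \<subseteq> verts K \<and> card e = 2" using KEJ eJ by simp
    then have sK: "subgraph K J"
      unfolding subgraph_def simple_graph_def using KJ KV by simp
    have "graph_iso J (complete_graph r)"
      unfolding graph_iso_def
    proof (intro exI conjI ballI)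
      show "bij_betw (the_inv_into {..<r} v) (verts J) (verts (complete_graph r))"
        using bij_betw_the_inv_into[OF inj_on_imp_bij_betw[OF inj]] JV by (simp add: complete_graph_def)
      fix x y assume "x \<in> verts J" "y \<in> verts J"
      then obtain i j where ij: "x = v i" "y = v j" "i < r" "j < r" using JV by auto
      have "{v i, v j} \<in> edges J \<longleftrightarrow> i \<noteq> j"
      proof
        assume "{v i, v j} \<in> edges J"
        then have "card {v i, v j} = 2" using eJ[of "{v i, v j}"] by simp
        then show "i \<noteq> j" by auto
      next
        assume "i \<noteq> j"
        then show "{v i, v j} \<in> edges J" unfolding JE using ij by auto
      qed
      moreover have "the_inv_into {..<r} v x = i" "the_inv_into {..<r} v y = j"
        using the_inv_into_f_f[OF inj] ij by auto
      ultimately show "{x, y} \<in> edges J \<longleftrightarrow>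
          {the_inv_into {..<r} v x, the_inv_into {..<r} v y} \<in> edges (complete_graph r)"
        using ij by (simp add: complete_graph_edge)
    qed
    moreover have "natural_drawing J (induced_drawing D J)"
    proof -
      obtain F where F: "F \<in> components (S2 - (\<Union>i<r. \<Union>j\<in>{..<r} - {i}. ecurve D {v i, v j}))"
        "(top_of_set S2) frontier_of F = hull_cycle r v"
        by (rule hull_cycle_bounds_face[OF v assms])
      \<comment> \<open>\<open>drawn\<close> also contains the vertex points, which must be seen to
        lie on edges already counted.\<close>
      have onK: "vpoint D (v i) \<in> ecurve D {v i, v (Suc i mod r)}" if "i < r" for i
        using E_ends(1)[of "v i" "v (Suc i mod r)"] vij[OF that, of "Suc i mod r"] vn[of i]
          vn[of "Suc i mod r"] suc[OF that] that by simp
      have "(\<Union>e\<in>edges K. ecurve D e) = hull_cycle r v"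
      proof -
        have "edges K = (\<lambda>i. {v i, v (Suc i mod r)}) ` {..<r}" unfolding K_def by auto
        then show ?thesis unfolding hull_cycle_def by simp
      qed
      moreover have "vpoint D ` verts K \<subseteq> hull_cycle r v"
        unfolding KV hull_cycle_def using onK by blast
      ultimately have dK: "drawn D K = hull_cycle r v"
        unfolding drawn_def by blast
      have EJ: "(\<Union>e\<in>edges J. ecurve D e) = (\<Union>i<r. \<Union>j\<in>{..<r} - {i}. ecurve D {v i, v j})"
      proof -
        have "edges J = (\<Union>i<r. (\<lambda>j. {v i, v j}) ` ({..<r} - {i}))"
        proof (rule set_eqI)
          fix e
          show "e \<in> edges J \<longleftrightarrow> e \<in> (\<Union>i<r. (\<lambda>j. {v i, v j}) ` ({..<r} - {i}))"
            unfolding JE by (simp only: UN_iff image_iff Bex_def Diff_iff lessThan_iff singleton_iff) metis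
        qed
        then show ?thesis by simp
      qed
      have "vpoint D ` verts J \<subseteq> (\<Union>e\<in>edges J. ecurve D e)"
      proof (clarsimp simp: JV)
        fix i assume "i < r"
        then have "{v i, v (Suc i mod r)} \<in> edges J" using KEJ KE by auto
        then show "\<exists>e\<in>edges J. vpoint D (v i) \<in> ecurve D e" using onK[OF \<open>i < r\<close>] by (rule rev_bexI)
      qed
      then have dJ: "drawn D J = (\<Union>i<r. \<Union>j\<in>{..<r} - {i}. ecurve D {v i, v j})"
        unfolding drawn_def EJ[symmetric] by (rule Un_absorb1)
      have card: "card (verts J) = r" unfolding JV using card_image[OF inj] by simp
      have "is_cycle r K"
        unfolding is_cycle_def
      proof (intro conjI exI[of _ "map v [0..<r]"])
        show "distinct (map v [0..<r])" using inj by (simp add: distinct_map lessThan_atLeast0)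
        show "verts K = set (map v [0..<r])" unfolding K_def by (simp add: lessThan_atLeast0)
        have "{map v [0..<r] ! i, map v [0..<r] ! (Suc i mod r)} = {v i, v (Suc i mod r)}" if "i < r" for i
          using that suc[OF that] by simp
        then show "edges K = {{map v [0..<r] ! i, map v [0..<r] ! (Suc i mod r)} |i. i < r}"
          unfolding K_def by force
      qed (use assms in auto)
      moreover have "is_drawing J (induced_drawing D J)"
        using subgraph_drawing[OF _ sJ] D unfolding convex_drawing_def by blast
      moreover have "is_face J (induced_drawing D J) F"
        unfolding is_face_def using F(1) dJ drawn_induced[of J J D] by simp
      moreover have "(top_of_set S2) frontier_of F = drawn (induced_drawing D J) K"
        using F(2) dK drawn_induced[OF KJ, of D] by simp
      ultimately show ?thesis
        unfolding natural_drawing_def card using sK by blast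
    qed
    ultimately show ?thesis using sJ by blast
  qed
  then show ?thesis by blast
qed

end
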